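(* Let $U$ be an optimal machine, run for $t$ steps on every input of length at most $n$. (a) If after $t$ steps at most $2^{n-k}$ terminating computations are still running, then $t\ge \mathrm{BB}(k-K(k\mid n)-O(1))$. (b) If after $t$ steps more than $2^{n-k}$ terminating computations are still running, then $t\le \mathrm{BB}(k+K(n)+O(1))$.
   Context: A machine is a partial computable function from binary strings to binary strings; for a machine $V$ let $C_V(x)=\min\{|p|\colon V(p)=x\}$ (plain Kolmogorov complexity with respect to $V$). $U$ is optimal if for every machine $V$ there is $c$ with $C_U(x)\le C_V(x)+c$ for all $x$. $\mathrm{BB}(n)$ (busy beaver function) is the maximal running time of terminating computations of $U$ on inputs of length at most $n$. $K(\cdot)$ and $K(\cdot\mid\cdot)$ denote prefix-free Kolmogorov complexity and its conditional version. A "terminating computation still running after $t$ steps" is a computation of $U$ on an input of length at most $n$ that eventually halts but has not halted within $t$ steps.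
   Formalization: The formal theorem assumes 0 ≤ k ≤ n, which the statement leaves implicit; for k > n part (a) fails (e.g. k = 2n, t = BB(n), n large), while part (b) is then immediate from t < BB(n). *)

theory Defs
  imports Main "HOL-Library.Extended_Nat"
begin

text \<open>Binary strings are bool lists. They are coded by natural numbers via the
bijective base-2 numeration enc (a bijection between bool lists and nat).\<close>

fun enc :: "bool list \<Rightarrow> nat" where
  "enc [] = 0"
| "enc (b # xs) = (if b then 2 else 1) + 2 * enc xs"

datatype instr = Inc nat nat | Dec nat nat nat

type_synonym prog = "instr list"
type_synonym config = "nat \<times> (nat \<Rightarrow> nat)"

fun step :: "prog \<Rightarrow> config \<Rightarrow> config" where
  "step P (pc, R) =
     (if pc < length P then
        (case P ! pc of
           Inc r j \<Rightarrow> (j, R(r := Suc (R r)))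
         | Dec r j k \<Rightarrow> (if R r > 0 then (j, R(r := R r - 1)) else (k, R)))
      else (pc, R))"

definition init :: "nat list \<Rightarrow> config" where
  "init xs = (0, \<lambda>i. if i < length xs then xs ! i else 0)"

definition halted :: "prog \<Rightarrow> config \<Rightarrow> bool" where
  "halted P c \<longleftrightarrow> length P \<le> fst c"

definition halts_within :: "prog \<Rightarrow> nat list \<Rightarrow> nat \<Rightarrow> bool" where
  "halts_within P xs t \<longleftrightarrow> halted P ((step P ^^ t) (init xs))"

definition halts :: "prog \<Rightarrow> nat list \<Rightarrow> bool" where
  "halts P xs \<longleftrightarrow> (\<exists>t. halts_within P xs t)"

definition runtime :: "prog \<Rightarrow> nat list \<Rightarrow> nat" where
  "runtime P xs = (LEAST t. halts_within P xs t)"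

definition out :: "prog \<Rightarrow> nat list \<Rightarrow> nat option" where
  "out P xs = (if halts P xs then Some (snd ((step P ^^ runtime P xs) (init xs)) 0) else None)"

text \<open>A program V represents the machine p \<mapsto> x where out V [enc p] = Some (enc x).
Every partial computable function on binary strings is of this form.\<close>

definition C :: "prog \<Rightarrow> bool list \<Rightarrow> enat" where
  "C V x = Inf {enat (length p) | p. out V [enc p] = Some (enc x)}"

definition optimal :: "prog \<Rightarrow> bool" where
  "optimal U \<longleftrightarrow> (\<forall>V. \<exists>c. \<forall>x. C U x \<le> C V x + enat c)"

text \<open>Conditional machine: (p, y) \<mapsto> out P [enc p, y]; natural numbers (objects
such as k, n) are identified with binary strings via the bijection enc.\<close>

definition prefix_free_cond :: "prog \<Rightarrow> bool" where
  "prefix_free_cond P \<longleftrightarrow>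
     (\<forall>y p r. halts P [enc p, y] \<longrightarrow> halts P [enc (p @ r), y] \<longrightarrow> r = [])"

definition Kc :: "prog \<Rightarrow> nat \<Rightarrow> nat \<Rightarrow> enat" where
  "Kc P x y = Inf {enat (length p) | p. out P [enc p, y] = Some x}"

definition optimal_pf :: "prog \<Rightarrow> bool" where
  "optimal_pf P \<longleftrightarrow> prefix_free_cond P \<and>
     (\<forall>Q. prefix_free_cond Q \<longrightarrow> (\<exists>c. \<forall>x y. Kc P x y \<le> Kc Q x y + enat c))"

text \<open>Unconditional K(x) = K(x | empty string); the empty string is coded by 0.\<close>

definition BB :: "prog \<Rightarrow> int \<Rightarrow> nat" where
  "BB U m = Max (insert 0 {runtime U [enc p] | p. int (length p) \<le> m \<and> halts U [enc p]})"

definition still_running :: "prog \<Rightarrow> nat \<Rightarrow> nat \<Rightarrow> nat" where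
  "still_running U n t =
     card {p. length p \<le> n \<and> halts U [enc p] \<and> t < runtime U [enc p]}"

end

theory Submission
  imports Defs "HOL-Library.Nat_Bijection"
begin

text \<open>Both parts rest on one device: once a machine \<open>V\<close> knows \<open>n\<close> and a time bound \<open>T\<close>, it can
print a string that no input of length at most \<open>n\<close> makes \<open>U\<close> print within \<open>T\<close> steps; by
optimality such a string still has a short program, which therefore runs for more than \<open>T\<close> steps.

(a) If \<open>t < BB(k - K(k|n) - O(1))\<close>, take a program \<open>p\<close> running longer than \<open>t\<close> and a shortest
program \<open>q\<close> for \<open>k\<close> given \<open>n\<close>. There is room for an arbitrary string \<open>z\<close> of length \<open>n - k + 1\<close>
next to \<open>q\<close> and \<open>p\<close>; letting the printed string depend injectively on \<open>z\<close> yields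
\<open>2 ^ (n - k + 1)\<close> programs that are still running after \<open>t\<close> steps.

(b) Let \<open>N\<close> be the number of terminating inputs of length at most \<open>n\<close>. The number
\<open>s = N div 2 ^ (n - k)\<close> has \<open>k + 1\<close> bits. Waiting until \<open>s * 2 ^ (n - k)\<close> inputs have halted takes a
time \<open>T\<close> that is larger than \<open>t\<close>, and \<open>T\<close> is computed from \<open>s\<close> and a shortest program for \<open>n\<close>.

In both cases a constant \<open>c\<close> caused by optimality has to be known to \<open>V\<close> although it depends
on \<open>V\<close>; it is passed as part of the input, in unary.\<close>

section \<open>Register machine computations\<close>

definition reach :: "prog \<Rightarrow> config \<Rightarrow> config \<Rightarrow> bool" where
  "reach P c d \<longleftrightarrow> (\<exists>t. (step P ^^ t) c = d)"

lemma reach_refl: "reach P c c"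
  unfolding reach_def by (rule exI[of _ 0]) simp

lemma reach_trans: "reach P c d \<Longrightarrow> reach P d e \<Longrightarrow> reach P c e"
  unfolding reach_def by (metis funpow_add comp_apply)

lemma reach_step: "reach P (step P c) d \<Longrightarrow> reach P c d"
  unfolding reach_def by (metis funpow_Suc_right comp_apply)

lemma step_halted: "halted P c \<Longrightarrow> step P c = c"
  by (cases c) (auto simp: halted_def)

lemma funpow_step_halted: "halted P c \<Longrightarrow> (step P ^^ t) c = c"
  by (induction t) (auto simp: step_halted)

lemma funpow_step_stable:
  assumes "halted P ((step P ^^ s) c)" and "s \<le> t"
  shows "(step P ^^ t) c = (step P ^^ s) c"
proof -
  have "(step P ^^ t) c = (step P ^^ (t - s)) ((step P ^^ s) c)"
    using assms(2) by (metis comp_apply funpow_add le_add_diff_inverse2)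
  then show ?thesis using funpow_step_halted[OF assms(1)] by simp
qed

lemma halts_within_mono: "halts_within P xs s \<Longrightarrow> s \<le> t \<Longrightarrow> halts_within P xs t"
  unfolding halts_within_def by (metis funpow_step_stable)

lemma halts_within_runtime: "halts P xs \<Longrightarrow> halts_within P xs (runtime P xs)"
  unfolding runtime_def halts_def by (rule LeastI_ex)

lemma halts_within_iff_runtime: "halts_within P xs t \<longleftrightarrow> halts P xs \<and> runtime P xs \<le> t"
proof
  assume "halts_within P xs t"
  then show "halts P xs \<and> runtime P xs \<le> t"
    unfolding runtime_def halts_def by (auto intro: Least_le)
next
  assume "halts P xs \<and> runtime P xs \<le> t"
  then show "halts_within P xs t"
    using halts_within_mono halts_within_runtime by blast
qed

lemma out_eq_Some_iff:
  "out P xs = Some v \<longleftrightarrow> (\<exists>t. halts_within P xs t \<and> snd ((step P ^^ t) (init xs)) 0 = v)"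
proof
  assume "out P xs = Some v"
  then show "\<exists>t. halts_within P xs t \<and> snd ((step P ^^ t) (init xs)) 0 = v"
    by (auto simp: out_def split: if_splits intro: halts_within_runtime
        intro!: exI[of _ "runtime P xs"])
next
  assume "\<exists>t. halts_within P xs t \<and> snd ((step P ^^ t) (init xs)) 0 = v"
  then obtain t where t: "halts_within P xs t" "snd ((step P ^^ t) (init xs)) 0 = v"
    by blast
  then have *: "halts P xs" "runtime P xs \<le> t" by (auto simp: halts_within_iff_runtime)
  then have "(step P ^^ t) (init xs) = (step P ^^ runtime P xs) (init xs)"
    using halts_within_runtime[of P xs] by (intro funpow_step_stable) (auto simp: halts_within_def)
  then show "out P xs = Some v" using t * by (simp add: out_def)
qed

lemma out_if_reach:
  assumes "reach P (init xs) (pc, R)" and "length P \<le> pc"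
  shows "out P xs = Some (R 0)"
proof -
  obtain t where "(step P ^^ t) (init xs) = (pc, R)" using assms(1) by (auto simp: reach_def)
  then show ?thesis using assms(2) by (auto simp: out_eq_Some_iff halts_within_def halted_def
      intro!: exI[of _ t])
qed

text \<open>Missing inputs are read as zero, so simulating two-input runs suffices. For the same
  reason \<open>0\<close>, the code of the empty string, serves as the empty condition in
  \<open>Kc P n 0\<close>.\<close>

lemma init_single: "init [x] = init [x, 0]"
  by (auto simp: init_def fun_eq_iff less_Suc_eq nth_Cons split: nat.splits)

lemma halts_single: "halts P [x] \<longleftrightarrow> halts P [x, 0]"
  by (simp add: halts_def halts_within_def init_single)

lemma out_single: "out P [x] = out P [x, 0]"
  by (simp add: out_def halts_single runtime_def halts_within_def init_single)

section \<open>Structured register programs\<close>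

datatype com = SKIP | INC nat | SEQ com com (infixr ";;" 60) | LOOP nat com

text \<open>\<open>LOOP r c\<close> decrements \<open>r\<close> before each pass and
  \<open>c\<close> may change \<open>r\<close> again, so it is a while loop that may diverge. Hence
  a relation, covering the terminating runs only.\<close>

inductive exec :: "com \<Rightarrow> (nat \<Rightarrow> nat) \<Rightarrow> (nat \<Rightarrow> nat) \<Rightarrow> bool" where
  exec_SKIP: "exec SKIP R R"
| exec_INC: "exec (INC r) R (R(r := Suc (R r)))"
| exec_SEQ: "exec c R R1 \<Longrightarrow> exec d R1 R2 \<Longrightarrow> exec (c ;; d) R R2"
| exec_LOOP_0: "R r = 0 \<Longrightarrow> exec (LOOP r c) R R"
| exec_LOOP_Suc: "R r = Suc n \<Longrightarrow> exec c (R(r := n)) R1 \<Longrightarrow> exec (LOOP r c) R1 R2 \<Longrightarrow>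
    exec (LOOP r c) R R2"

fun clen :: "com \<Rightarrow> nat" where
  "clen SKIP = 0"
| "clen (INC r) = 1"
| "clen (c ;; d) = clen c + clen d"
| "clen (LOOP r c) = clen c + 3"

text \<open>The last two instructions of a loop form an unconditional jump: an increment
of register 0 that is immediately undone.\<close>

fun compile :: "nat \<Rightarrow> com \<Rightarrow> prog" where
  "compile b SKIP = []"
| "compile b (INC r) = [Inc r (Suc b)]"
| "compile b (c ;; d) = compile b c @ compile (b + clen c) d"
| "compile b (LOOP r c) = Dec r (Suc b) (b + clen c + 3) # compile (Suc b) c @
     [Inc 0 (b + clen c + 2), Dec 0 b b]"

lemma length_compile [simp]: "length (compile b c) = clen c"
  by (induction c arbitrary: b) auto

lemma compile_loop_back:
  assumes "P = xs @ compile (length xs) (LOOP r c) @ ys"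
  shows "(step P ^^ 2) (length xs + clen c + 1, R) = (length xs, R)"
  using assms by (simp add: numeral_2_eq_2 nth_append fun_upd_idem)

text \<open>Jump targets are absolute, so code is compiled for its start address
  \<open>length xs\<close>. Arbitrary surroundings \<open>xs\<close> and \<open>ys\<close> let the
  induction hypotheses apply to parts of sequences and to loop bodies.\<close>

lemma compile_correct:
  assumes "exec c R R'"
  shows "reach (xs @ compile (length xs) c @ ys) (length xs, R) (length xs + clen c, R')"
  using assms
proof (induction arbitrary: xs ys rule: exec.induct)
  case (exec_SKIP R)
  then show ?case by (simp add: reach_refl)
next
  case (exec_INC r R)
  show ?case by (rule reach_step) (simp add: reach_refl del: fun_upd_apply)
next
  case (exec_SEQ c R R1 d R2)
  show ?case
    using reach_trans[OF exec_SEQ.IH(1)[of xs "compile (length xs + clen c) d @ ys"]]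
      exec_SEQ.IH(2)[of "xs @ compile (length xs) c" ys]
    by (simp add: add.assoc)
next
  case (exec_LOOP_0 R r c)
  then show ?case by - (rule reach_step, simp add: reach_refl add_ac)
next
  case (exec_LOOP_Suc R r n c R1 R2)
  define P where "P = xs @ compile (length xs) (LOOP r c) @ ys"
  have "reach P (Suc (length xs), R(r := n)) (length xs + clen c + 1, R1)"
    using exec_LOOP_Suc.IH(1)[of "xs @ [Dec r (Suc (length xs)) (length xs + clen c + 3)]"
       "[Inc 0 (length xs + clen c + 2), Dec 0 (length xs) (length xs)] @ ys"]
    by (simp add: P_def add_ac del: fun_upd_apply)
  moreover have "reach P (length xs + clen c + 1, R1) (length xs, R1)"
    using compile_loop_back[OF P_def] unfolding reach_def by blast
  moreover have "reach P (length xs, R1) (length xs + clen (LOOP r c), R2)"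
    using exec_LOOP_Suc.IH(2)[of xs ys] by (simp add: P_def)
  ultimately have "reach P (Suc (length xs), R(r := n)) (length xs + clen (LOOP r c), R2)"
    by (blast intro: reach_trans)
  then have "reach P (length xs, R) (length xs + clen (LOOP r c), R2)"
    using exec_LOOP_Suc.hyps(1) by - (rule reach_step, simp add: P_def del: fun_upd_apply)
  then show ?case by (simp add: P_def)
qed

text \<open>Halting is absorbing, so a run that visits the loop head at arbitrarily late times never
  halts. The invariant keeps the guard positive and makes every pass end in the invariant
  again.\<close>

lemma compile_LOOP_diverges:
  assumes P: "P = xs @ compile (length xs) (LOOP r c) @ ys"
    and inv: "\<And>R. I R \<Longrightarrow> R r > 0 \<and> (\<exists>R'. exec c (R(r := R r - 1)) R' \<and> I R')"
    and start: "I R"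
  shows "\<not> halted P ((step P ^^ t) (length xs, R))"
proof -
  have "\<exists>s\<ge>t. \<exists>R'. (step P ^^ s) (length xs, R) = (length xs, R') \<and> I R'"
  proof (induction t)
    case 0
    show ?case using start by (auto intro: exI[of _ 0])
  next
    case (Suc t)
    then obtain s R1 where s: "s \<ge> t" "(step P ^^ s) (length xs, R) = (length xs, R1)" "I R1"
      by blast
    then obtain R2 where R2: "exec c (R1(r := R1 r - 1)) R2" "I R2" "R1 r > 0"
      using inv by blast
    have "reach P (Suc (length xs), R1(r := R1 r - 1)) (length xs + clen c + 1, R2)"
      using compile_correct[OF R2(1), of "xs @ [Dec r (Suc (length xs)) (length xs + clen c + 3)]"
         "[Inc 0 (length xs + clen c + 2), Dec 0 (length xs) (length xs)] @ ys"]
      by (simp add: P add_ac)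
    moreover have "reach P (length xs + clen c + 1, R2) (length xs, R2)"
      using compile_loop_back[OF P] unfolding reach_def by blast
    moreover have "step P (length xs, R1) = (Suc (length xs), R1(r := R1 r - 1))"
      using R2(3) by (simp add: P)
    ultimately have "reach P (step P (length xs, R1)) (length xs, R2)"
      by (metis reach_trans)
    then obtain u where "(step P ^^ u) (step P (length xs, R1)) = (length xs, R2)"
      by (auto simp: reach_def)
    then have "(step P ^^ (u + Suc s)) (length xs, R) = (length xs, R2)"
      by (simp add: funpow_add s(2) funpow_swap1 del: step.simps)
    then show ?case using s(1) R2(2) by (intro exI[of _ "u + Suc s"]) auto
  qed
  then obtain s R' where s: "s \<ge> t" "(step P ^^ s) (length xs, R) = (length xs, R')" by blast
  show ?thesis
  proof
    assume h: "halted P ((step P ^^ t) (length xs, R))"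
    then have "halted P (length xs, R')" using funpow_step_stable[OF h s(1)] s(2) by simp
    then show False by (simp add: halted_def P)
  qed
qed

section \<open>Clearing, moving and copying registers\<close>

lemma exec_clear: "exec (LOOP r SKIP) R (R(r := 0))"
proof (induction "R r" arbitrary: R)
  case 0
  then show ?case using exec_LOOP_0[of R r SKIP] by (simp add: fun_upd_idem)
next
  case (Suc n)
  have "exec (LOOP r SKIP) (R(r := n)) ((R(r := n))(r := 0))" by (rule Suc) simp
  then show ?case using exec_LOOP_Suc[of R r n, OF Suc(2)[symmetric] exec_SKIP] by simp
qed

lemma exec_move: "r \<noteq> s \<Longrightarrow> exec (LOOP r (INC s)) R (R(r := 0, s := R s + R r))"
proof (induction "R r" arbitrary: R)
  case 0
  then show ?case using exec_LOOP_0[of R r "INC s"] by (simp add: fun_upd_idem)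
next
  case (Suc n)
  let ?R = "R(r := n, s := Suc (R s))"
  have "exec (LOOP r (INC s)) ?R (?R(r := 0, s := ?R s + ?R r))"
    by (rule Suc) (use Suc.prems in auto)
  moreover have "?R(r := 0, s := ?R s + ?R r) = R(r := 0, s := R s + R r)"
    using Suc by (auto simp: fun_eq_iff)
  moreover have "exec (INC s) (R(r := n)) ?R"
    using exec_INC[of s "R(r := n)"] Suc.prems by simp
  ultimately show ?case using exec_LOOP_Suc[of R r n, OF Suc(2)[symmetric]] by metis
qed

lemma exec_move2:
  "r \<noteq> s \<Longrightarrow> r \<noteq> u \<Longrightarrow> s \<noteq> u \<Longrightarrow>
    exec (LOOP r (INC s ;; INC u)) R (R(r := 0, s := R s + R r, u := R u + R r))"
proof (induction "R r" arbitrary: R)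
  case 0
  then show ?case using exec_LOOP_0[of R r "INC s ;; INC u"] by (simp add: fun_upd_idem)
next
  case (Suc n)
  let ?R = "R(r := n, s := Suc (R s), u := Suc (R u))"
  have "exec (LOOP r (INC s ;; INC u)) ?R (?R(r := 0, s := ?R s + ?R r, u := ?R u + ?R r))"
    by (rule Suc) (use Suc.prems in auto)
  moreover have "?R(r := 0, s := ?R s + ?R r, u := ?R u + ?R r)
      = R(r := 0, s := R s + R r, u := R u + R r)"
    using Suc by (auto simp: fun_eq_iff)
  moreover have "exec (INC s ;; INC u) (R(r := n)) ?R"
    using exec_SEQ[OF exec_INC[of s "R(r := n)"] exec_INC[of u]] Suc.prems by simp
  ultimately show ?case using exec_LOOP_Suc[of R r n, OF Suc(2)[symmetric]] by metis
qed

text \<open>A loop destroys its counter, so the value is sent to both \<open>s\<close> and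
  \<open>u\<close> and then restored from \<open>u\<close>.\<close>

definition copy :: "nat \<Rightarrow> nat \<Rightarrow> nat \<Rightarrow> com" where
  "copy r s u = LOOP s SKIP ;; LOOP u SKIP ;; LOOP r (INC s ;; INC u) ;; LOOP u (INC r)"

lemma exec_copy:
  assumes "r \<noteq> s" "r \<noteq> u" "s \<noteq> u"
  shows "exec (copy r s u) R (R(s := R r, u := 0))"
proof -
  have "exec (LOOP r (INC s ;; INC u)) (R(s := 0, u := 0)) (R(r := 0, s := R r, u := R r))"
    using exec_move2[OF assms, of "R(s := 0, u := 0)"] assms
    by (simp add: fun_upd_twist)
  moreover have "exec (LOOP u (INC r)) (R(r := 0, s := R r, u := R r)) (R(s := R r, u := 0))"
  proof -
    have "(R(r := 0, s := R r, u := R r))(u := 0, r := R r) = R(s := R r, u := 0)"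
      using assms by (auto simp: fun_eq_iff)
    then show ?thesis
      using exec_move[of u r "R(r := 0, s := R r, u := R r)"] assms by simp
  qed
  ultimately show ?thesis
    unfolding copy_def by (blast intro: exec_SEQ exec_clear)
qed

section \<open>Computable functions of an environment\<close>

text \<open>The variables of the environment live in the registers \<open>\<rho> i\<close>, all below \<open>M\<close>;
the value is delivered in register \<open>M\<close> and everything above \<open>M\<close> is scratch space,
not assumed to be zero. The range of \<open>\<rho>\<close> is bounded although there are infinitely many
variables, so almost all of them share registers.\<close>

definition computes :: "com \<Rightarrow> (nat \<Rightarrow> nat) \<Rightarrow> nat \<Rightarrow> ((nat \<Rightarrow> nat) \<Rightarrow> nat) \<Rightarrow> bool" where
  "computes c \<rho> M f \<longleftrightarrow>
     (\<forall>R. \<exists>R'. exec c R R' \<and> R' M = f (\<lambda>i. R (\<rho> i)) \<and> (\<forall>i<M. R' i = R i))"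

definition computable :: "((nat \<Rightarrow> nat) \<Rightarrow> nat) \<Rightarrow> bool" where
  "computable f \<longleftrightarrow> (\<forall>\<rho> M. (\<forall>i. \<rho> i < M) \<longrightarrow> (\<exists>c. computes c \<rho> M f))"

text \<open>Renaming variables only changes the register assignment, and \<open>computable\<close>
  provides a program for every assignment.\<close>

lemma computable_rename: "computable f \<Longrightarrow> computable (\<lambda>e. f (\<lambda>i. e (s i)))"
  unfolding computable_def computes_def
proof (intro allI impI)
  fix \<rho> :: "nat \<Rightarrow> nat" and M
  assume f: "\<forall>\<rho> M. (\<forall>i. \<rho> i < M) \<longrightarrow> (\<exists>c. \<forall>R. \<exists>R'. exec c R R' \<and>
      R' M = f (\<lambda>i. R (\<rho> i)) \<and> (\<forall>i<M. R' i = R i))" and \<rho>: "\<forall>i. \<rho> i < M"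
  show "\<exists>c. \<forall>R. \<exists>R'. exec c R R' \<and> R' M = f (\<lambda>i. R (\<rho> (s i))) \<and> (\<forall>i<M. R' i = R i)"
    using f[rule_format, of "\<lambda>i. \<rho> (s i)" M] \<rho> by blast
qed

lemma computable_var: "computable (\<lambda>e. e i)"
  unfolding computable_def
proof (intro allI impI)
  fix \<rho> :: "nat \<Rightarrow> nat" and M assume \<rho>: "\<forall>i. \<rho> i < M"
  have "exec (copy (\<rho> i) M (Suc M)) R (R(M := R (\<rho> i), Suc M := 0))" for R
    using \<rho>[rule_format, of i] by (intro exec_copy) auto
  then have "computes (copy (\<rho> i) M (Suc M)) \<rho> M (\<lambda>e. e i)"
    unfolding computes_def by fastforce
  then show "\<exists>c. computes c \<rho> M (\<lambda>e. e i)" ..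
qed

lemma computable_0: "computable (\<lambda>e. 0)"
  unfolding computable_def computes_def
proof (intro allI impI)
  fix \<rho> :: "nat \<Rightarrow> nat" and M
  show "\<exists>c. \<forall>R. \<exists>R'. exec c R R' \<and> R' M = 0 \<and> (\<forall>i<M. R' i = R i)"
    using exec_clear by (intro exI[of _ "LOOP M SKIP"]) fastforce
qed

lemma computable_Suc: 
  assumes "computable f"
  shows "computable (\<lambda>e. Suc (f e))"
  unfolding computable_def 
proof (intro allI impI)
  fix \<rho> :: "nat \<Rightarrow> nat" and M assume "\<forall>i. \<rho> i < M"
  then obtain c where c: "computes c \<rho> M f" using assms unfolding computable_def by blast
  have "computes (c ;; INC M) \<rho> M (\<lambda>e. Suc (f e))"
    unfolding computes_def
  proof
    fix R
    obtain R' where R': "exec c R R'" "R' M = f (\<lambda>i. R (\<rho> i))" "\<forall>i<M. R' i = R i"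
      using c unfolding computes_def by blast
    then show "\<exists>R'. exec (c ;; INC M) R R' \<and> R' M = Suc (f (\<lambda>i. R (\<rho> i))) \<and> (\<forall>i<M. R' i = R i)"
      using exec_SEQ[OF R'(1) exec_INC[of M R']]
      by (intro exI[of _ "R'(M := Suc (R' M))"]) simp
  qed
  then show "\<exists>c. computes c \<rho> M (\<lambda>e. Suc (f e))" ..
qed

lemma computable_rec:
  assumes f: "computable f" and g: "computable g"
    and h: "computable (\<lambda>e. h (e 0) (e (Suc 0)) (\<lambda>i. e (Suc (Suc i))))"
  shows "computable (\<lambda>e. rec_nat (f e) (\<lambda>m a. h m a e) (g e))"
  unfolding computable_def
proof (intro allI impI)
  fix \<rho> :: "nat \<Rightarrow> nat" and M assume \<rho>: "\<forall>i. \<rho> i < M"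
  \<comment> \<open>Register \<open>M\<close> holds the accumulator, \<open>M + 1\<close> the number
    of remaining passes, \<open>M + 2\<close> the index of the pass and \<open>M + 3\<close> the new
    value. \<open>\<rho>'\<close> hands index and accumulator to \<open>h\<close> as variables 0 and
    1.\<close>
  define \<rho>' where "\<rho>' = case_nat (M + 2) (case_nat M \<rho>)"
  have \<rho>M: "\<rho> i < M" for i using \<rho> by blast
  have "\<rho>' i < M + 3" for i
    using \<rho>M by (auto simp: \<rho>'_def less_SucI split: nat.split intro: less_trans[OF \<rho>M])
  moreover have "\<rho> i < Suc M" for i using \<rho>M less_SucI by blast
  ultimately obtain cf cg ch where cf: "computes cf \<rho> M f" and cg: "computes cg \<rho> (Suc M) g"
    and ch: "computes ch \<rho>' (M + 3) (\<lambda>e. h (e 0) (e (Suc 0)) (\<lambda>i. e (Suc (Suc i))))"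
    using f g h \<rho> unfolding computable_def by meson
  define body where
    "body = ch ;; LOOP M SKIP ;; LOOP (M + 3) (INC M) ;; INC (M + 2)"
  have body: "\<exists>R'. exec body R R' \<and> R' M = h (R (M + 2)) (R M) (\<lambda>i. R (\<rho> i)) \<and>
      R' (M + 2) = Suc (R (M + 2)) \<and> R' (M + 1) = R (M + 1) \<and> (\<forall>i<M. R' i = R i)" for R
  proof -
    obtain R1 where R1: "exec ch R R1" "R1 (M + 3) = h (R (M + 2)) (R M) (\<lambda>i. R (\<rho> i))"
      "\<forall>i<M+3. R1 i = R i"
      using ch unfolding computes_def by (auto simp: \<rho>'_def)
    let ?R2 = "R1(M := 0)" let ?R3 = "?R2(M + 3 := 0, M := ?R2 M + ?R2 (M + 3))"
    have "exec body R (?R3(M + 2 := Suc (?R3 (M + 2))))"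
      unfolding body_def
      by (intro exec_SEQ[OF R1(1)] exec_SEQ[OF exec_clear] exec_SEQ[OF exec_move] exec_INC) simp
    then show ?thesis
      using R1 by (intro exI[of _ "?R3(M + 2 := Suc (?R3 (M + 2)))"] conjI) auto
  qed
  \<comment> \<open>Each pass shifts one unit from \<open>M + 1\<close> to \<open>M + 2\<close>, so
    their sum is the fixed final index of the recursion.\<close>
  have loop: "\<exists>R'. exec (LOOP (M + 1) body) R R' \<and>
      R' M = rec_nat x (\<lambda>m a. h m a (\<lambda>i. R (\<rho> i))) (R (M + 2) + R (M + 1)) \<and> (\<forall>i<M. R' i = R i)"
    if "R M = rec_nat x (\<lambda>m a. h m a (\<lambda>i. R (\<rho> i))) (R (M + 2))" for R x
    using that
  proof (induction "R (M + 1)" arbitrary: R)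
    case 0
    then show ?case by (intro exI[of _ R]) (auto intro: exec_LOOP_0)
  next
    case (Suc n)
    obtain R1 where R1: "exec body (R(M + 1 := n)) R1"
      "R1 M = h (R (M + 2)) (R M) (\<lambda>i. R (\<rho> i))"
      "R1 (M + 2) = Suc (R (M + 2))" "R1 (M + 1) = n" "\<forall>i<M. R1 i = R i"
    proof -
      have "\<rho> i \<noteq> M + 1" for i using \<rho>M[of i] by simp
      then show ?thesis using body[of "R(M + 1 := n)"] that by auto
    qed
    have eq: "(\<lambda>i. R1 (\<rho> i)) = (\<lambda>i. R (\<rho> i))" using R1(5) \<rho>M by auto
    obtain R2 where "exec (LOOP (M + 1) body) R1 R2"
      "R2 M = rec_nat x (\<lambda>m a. h m a (\<lambda>i. R1 (\<rho> i))) (R1 (M + 2) + R1 (M + 1))" "\<forall>i<M. R2 i = R1 i"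
      using Suc.hyps(1)[of R1] R1 Suc.prems unfolding eq by (simp del: add_2_eq_Suc') blast
    moreover have "R1 (M + 2) + R1 (M + 1) = R (M + 2) + R (M + 1)"
      using R1(3,4) Suc.hyps(2) by simp
    moreover have "exec (LOOP (M + 1) body) R R2"
      using exec_LOOP_Suc[of R "M + 1" n, OF Suc.hyps(2)[symmetric] R1(1) calculation(1)] .
    ultimately show ?case using R1(5) unfolding eq by auto
  qed
  have "computes (cf ;; cg ;; LOOP (M + 2) SKIP ;; LOOP (M + 1) body) \<rho> M
      (\<lambda>e. rec_nat (f e) (\<lambda>m a. h m a e) (g e))"
    unfolding computes_def
  proof
    fix R
    obtain R1 where R1: "exec cf R R1" "R1 M = f (\<lambda>i. R (\<rho> i))" "\<forall>i<M. R1 i = R i"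
      using cf unfolding computes_def by blast
    obtain R2 where R2: "exec cg R1 R2" "R2 (M + 1) = g (\<lambda>i. R1 (\<rho> i))" "\<forall>i<Suc M. R2 i = R1 i"
      using cg unfolding computes_def by auto
    let ?R3 = "R2(M + 2 := 0)"
    have e1: "(\<lambda>i. R1 (\<rho> i)) = (\<lambda>i. R (\<rho> i))" using R1(3) \<rho>M by auto
    have e3: "(\<lambda>i. ?R3 (\<rho> i)) = (\<lambda>i. R (\<rho> i))"
    proof
      fix i show "?R3 (\<rho> i) = R (\<rho> i)"
        using R1(3) R2(3) \<rho>M[of i] by auto
    qed
    have "?R3 M = rec_nat (f (\<lambda>i. R (\<rho> i))) (\<lambda>m a. h m a (\<lambda>i. ?R3 (\<rho> i))) (?R3 (M + 2))"
      using R1 R2 by simp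
    from loop[OF this] obtain R4 where R4: "exec (LOOP (M + 1) body) ?R3 R4"
      "R4 M = rec_nat (f (\<lambda>i. R (\<rho> i))) (\<lambda>m a. h m a (\<lambda>i. R (\<rho> i))) (g (\<lambda>i. R (\<rho> i)))"
      "\<forall>i<M. R4 i = ?R3 i"
      unfolding e3 using R2(2) e1 by (auto simp del: fun_upd_apply simp: fun_upd_same fun_upd_other)
    have "exec (cf ;; cg ;; LOOP (M + 2) SKIP ;; LOOP (M + 1) body) R R4"
      using R1(1) R2(1) R4(1) exec_clear by (blast intro: exec_SEQ)
    then show "\<exists>R'. exec (cf ;; cg ;; LOOP (M + 2) SKIP ;; LOOP (M + 1) body) R R' \<and>
        R' M = rec_nat (f (\<lambda>i. R (\<rho> i))) (\<lambda>m a. h m a (\<lambda>i. R (\<rho> i))) (g (\<lambda>i. R (\<rho> i))) \<and>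
        (\<forall>i<M. R' i = R i)"
      using R4 R1(3) R2(3) by (intro exI[of _ R4]) auto
  qed
  then show "\<exists>c. computes c \<rho> M (\<lambda>e. rec_nat (f e) (\<lambda>m a. h m a e) (g e))" ..
qed

text \<open>The closure rules for \<open>computable\<close> need no more than primitive recursion;
  partiality enters through this one unbounded search. Divergence in the absence of a witness gives
  control over the domain, as needed for prefix-freeness.\<close>

lemma search_machine:
  assumes Q: "computable (\<lambda>e. of_bool (Q (e 0) (e (Suc 0)) (e (Suc (Suc 0)))))"
    and G: "computable (\<lambda>e. G (e 0))"
  shows "\<exists>V. \<forall>x y. out V [x, y] =
    (if \<exists>s. Q s x y then Some (G (LEAST s. Q s x y)) else None)"
proof -
  \<comment> \<open>The candidate \<open>s\<close> lives in register 3, the inputs \<open>x\<close>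
    and \<open>y\<close> in 0 and 1; all other variables share register 2.\<close>
  define \<rho> :: "nat \<Rightarrow> nat" where "\<rho> = case_nat 3 (case_nat 0 (case_nat 1 (\<lambda>_. 2)))"
  have \<rho>: "\<rho> 0 = 3" "\<rho> (Suc 0) = 0" "\<rho> (Suc (Suc 0)) = 1" by (simp_all add: \<rho>_def)
  have \<rho>4: "\<forall>i. \<rho> i < 4" by (auto simp: \<rho>_def split: nat.split)
  \<comment> \<open>Negation of a truth value as a recursion of length 0 or 1.\<close>
  have nQ: "computable (\<lambda>e. rec_nat 1 (\<lambda>_ _. 0) (of_bool (Q (e 0) (e (Suc 0)) (e (Suc (Suc 0))))))"
    by (rule computable_rec[OF _ Q computable_0]) (simp add: computable_Suc computable_0)
  obtain c where "computes c \<rho> 4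
      (\<lambda>e. rec_nat 1 (\<lambda>_ _. 0) (of_bool (Q (e 0) (e (Suc 0)) (e (Suc (Suc 0))))))"
    using nQ \<rho>4 unfolding computable_def by blast
  then have c: "\<exists>R'. exec c R R' \<and> R' 4 = of_bool (\<not> Q (R 3) (R 0) (R 1)) \<and> (\<forall>i<4. R' i = R i)" for R
    unfolding computes_def by (auto simp: \<rho> dest!: spec[of _ R])
  obtain g where "computes g \<rho> 4 (\<lambda>e. G (e 0))"
    using G \<rho>4 unfolding computable_def by blast
  then have g: "\<exists>R'. exec g R R' \<and> R' 4 = G (R 3)" for R
    unfolding computes_def by (auto simp: \<rho>)
  \<comment> \<open>The negated test, which \<open>c\<close> leaves in register 4, is itself the
    loop guard: candidates are increased until the test succeeds.\<close>
  define loop where "loop = LOOP 4 (INC 3 ;; c)"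
  define main where "main = c ;; loop ;; g ;; LOOP 0 SKIP ;; LOOP 4 (INC 0)"
  define V where "V = compile 0 main"
  have "out V [x, y] = (if \<exists>s. Q s x y then Some (G (LEAST s. Q s x y)) else None)" for x y
  proof -
    define Inv where "Inv = (\<lambda>s R. R 0 = x \<and> R 1 = y \<and> R 3 = s \<and> R (4::nat) = (of_bool (\<not> Q s x y) :: nat))"
    have body: "\<exists>R'. exec (INC 3 ;; c) (R(4 := R 4 - 1)) R' \<and> Inv (Suc s) R'" if "Inv s R" for s R
    proof -
      let ?R = "R(4 := R 4 - 1, 3 := Suc s)"
      have "exec (INC 3) (R(4 := R 4 - 1)) ?R"
        using exec_INC[of 3 "R(4 := R 4 - 1)"] that by (simp add: Inv_def)
      moreover obtain R' where R': "exec c ?R R'" "R' 4 = of_bool (\<not> Q (?R 3) (?R 0) (?R 1))"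
        "\<forall>i<4. R' i = ?R i"
        using c[of ?R] by blast
      moreover have "Inv (Suc s) R'"
        using that R'(2) R'(3)[rule_format, of 0] R'(3)[rule_format, of 1] R'(3)[rule_format, of 3]
        by (simp add: Inv_def)
      ultimately show ?thesis by (blast intro: exec_SEQ)
    qed
    obtain R0 where R0: "init [x, y] = (0, R0)" "R0 0 = x" "R0 1 = y" "R0 3 = 0"
      by (simp add: init_def)
    obtain R1 where R1: "exec c R0 R1" "Inv 0 R1"
      using c[of R0] R0 by (auto simp: Inv_def)
    show ?thesis
    proof (cases "\<exists>s. Q s x y")
      case True
      define n where "n = (LEAST s. Q s x y)"
      have n: "Q n x y" "\<And>s. s < n \<Longrightarrow> \<not> Q s x y"
        using True by (auto simp: n_def intro: LeastI_ex dest: not_less_Least)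
      have "\<exists>R'. exec loop R R' \<and> Inv n R'" if "s \<le> n" "Inv s R" for s R
        using that
      proof (induction arbitrary: R rule: inc_induct)
        case base
        then show ?case using n(1) by (auto simp: Inv_def loop_def intro: exec_LOOP_0)
      next
        case (step s)
        then have R4: "R 4 = Suc 0" using n(2)[of s] by (simp add: Inv_def)
        obtain R' where R': "exec (INC 3 ;; c) (R(4 := 0)) R'" "Inv (Suc s) R'"
          using body[OF step.prems] R4 by auto
        then show ?case using step.IH[OF R'(2)] exec_LOOP_Suc[of R 4, OF R4 R'(1)]
          unfolding loop_def by blast
      qed
      then obtain R2 where R2: "exec loop R1 R2" "Inv n R2" using R1(2) by blast
      obtain R3 where R3: "exec g R2 R3" "R3 4 = G n" using g[of R2] R2(2) by (auto simp: Inv_def)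
      have "exec main R0 ((R3(0 := 0))(4 := 0, 0 := (R3(0 := 0)) 0 + (R3(0 := 0)) 4))"
        unfolding main_def
        by (intro exec_SEQ[OF R1(1)] exec_SEQ[OF R2(1)] exec_SEQ[OF R3(1)]
            exec_SEQ[OF exec_clear] exec_move) simp
      from compile_correct[OF this, of "[]" "[]"]
      have "out V [x, y] = Some (((R3(0 := 0))(4 := 0, 0 := (R3(0 := 0)) 0 + (R3(0 := 0)) 4)) 0)"
        using out_if_reach[of V "[x, y]" "clen main"] by (simp add: V_def R0)
      then show ?thesis using True R3 by (simp add: n_def)
    next
      case False
      let ?xs = "compile 0 c"
      have V: "V = ?xs @ compile (length ?xs) loop @
          compile (clen c + clen loop) (g ;; LOOP 0 SKIP ;; LOOP 4 (INC 0))"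
        by (simp add: V_def main_def)
      have "reach V (0, R0) (clen c, R1)"
        using compile_correct[OF R1(1), of "[]"] by (simp add: V)
      then obtain s where s: "(step V ^^ s) (0, R0) = (clen c, R1)" by (auto simp: reach_def)
      have div: "\<not> halted V ((step V ^^ t) (clen c, R1))" for t
        using compile_LOOP_diverges[of V ?xs 4 "INC 3 ;; c" _ "\<lambda>R. \<exists>s. Inv s R" R1 t]
          V body R1(2) False unfolding loop_def by (fastforce simp: Inv_def)
      have "\<not> halts V [x, y]"
      proof
        assume "halts V [x, y]"
        then obtain t where t: "halted V ((step V ^^ t) (0, R0))"
          by (auto simp: halts_def halts_within_def R0)
        then have "halted V ((step V ^^ (t + s)) (0, R0))"
          using funpow_step_stable[of V t "(0, R0)" "t + s"] by simp
        then show False using div[of t] by (simp add: funpow_add s)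
      qed
      then show ?thesis using False by (simp add: out_def)
    qed
  qed
  then show ?thesis by blast
qed

section \<open>Arithmetic\<close>

lemma computable_weaken2: "computable f \<Longrightarrow> computable (\<lambda>e. f (\<lambda>i. e (Suc (Suc i))))"
  by (rule computable_rename)

lemma computable_const: "computable (\<lambda>e. n)"
  by (induction n) (auto intro: computable_0 computable_Suc)

lemma computable_add:
  assumes "computable f" "computable g"
  shows "computable (\<lambda>e. f e + g e)"
proof -
  have eq: "rec_nat a (\<lambda>_. Suc) n = a + n" for a n :: nat by (induction n) auto
  have "computable (\<lambda>e. rec_nat (f e) (\<lambda>m a. Suc a) (g e))"
    by (intro computable_rec computable_Suc computable_var assms)
  then show ?thesis by (simp add: eq)
qed

lemma computable_mult:
  assumes "computable f" "computable g"
  shows "computable (\<lambda>e. f e * g e)"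
proof -
  have eq: "rec_nat 0 (\<lambda>_ b. b + a) n = a * n" for a n :: nat by (induction n) auto
  have "computable (\<lambda>e. rec_nat 0 (\<lambda>m b. b + f e) (g e))"
    by (intro computable_rec computable_0 computable_var computable_add assms
      computable_weaken2[OF assms(1)])
  then show ?thesis by (simp add: eq)
qed

lemma computable_power:
  assumes "computable f" "computable g"
  shows "computable (\<lambda>e. f e ^ g e)"
proof -
  have eq: "rec_nat 1 (\<lambda>_ b. b * a) n = a ^ n" for a n :: nat by (induction n) auto
  have "computable (\<lambda>e. rec_nat 1 (\<lambda>m b. b * f e) (g e))"
    by (intro computable_rec computable_const computable_var computable_mult assms
      computable_weaken2[OF assms(1)])
  then show ?thesis by (simp only: eq)
qed

lemma computable_diff:
  assumes "computable f" "computable g"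
  shows "computable (\<lambda>e. f e - g e)"
proof -
  have eq1: "rec_nat 0 (\<lambda>m b. m) n = n - 1" for n :: nat by (cases n) auto
  have eq: "rec_nat a (\<lambda>_ b. b - 1) n = a - n" for a n :: nat by (induction n) auto
  have pred: "computable (\<lambda>e. e i - 1)" for i
    using computable_rec[of "\<lambda>_. 0" "\<lambda>e. e i" "\<lambda>m b e. m", OF computable_0 computable_var computable_var]
    by (simp only: eq1)
  have "computable (\<lambda>e. rec_nat (f e) (\<lambda>m b. b - 1) (g e))"
    by (intro computable_rec computable_var assms pred)
  then show ?thesis by (simp only: eq)
qed

section \<open>Decidable predicates and bounded operators\<close>

definition decidable :: "((nat \<Rightarrow> nat) \<Rightarrow> bool) \<Rightarrow> bool" where
  "decidable Q \<longleftrightarrow> computable (\<lambda>e. of_bool (Q e))"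

lemma computable_of_bool: "decidable Q \<Longrightarrow> computable (\<lambda>e. of_bool (Q e))"
  by (simp add: decidable_def)

text \<open>A truth value is the length of a recursion with at most one step: the start value is the
  else branch, the step returns the then branch.\<close>

lemma computable_if:
  assumes "decidable Q" "computable f" "computable g"
  shows "computable (\<lambda>e. if Q e then f e else g e)"
proof -
  have eq: "rec_nat b (\<lambda>_ _. a) (of_bool q) = (if q then a else b)" for q and a b :: nat by simp
  have "computable (\<lambda>e. rec_nat (g e) (\<lambda>_ _. f e) (of_bool (Q e)))"
    by (intro computable_rec computable_of_bool assms computable_weaken2[OF assms(2)])
  then show ?thesis by (simp only: eq)
qed

lemma decidable_const: "decidable (\<lambda>_. b)"
  unfolding decidable_def by (rule computable_const)

lemma decidable_not:
  assumes "decidable Q" shows "decidable (\<lambda>e. \<not> Q e)"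
  using computable_if[OF assms computable_const[of 0] computable_const[of 1]]
  unfolding decidable_def of_bool_def by (rule back_subst[of computable]) auto

lemma decidable_conj:
  assumes "decidable Q" "decidable S" shows "decidable (\<lambda>e. Q e \<and> S e)"
  using computable_if[OF assms(1) computable_of_bool[OF assms(2)] computable_const[of 0]]
  unfolding decidable_def of_bool_def by (rule back_subst[of computable]) auto

lemma decidable_eq_0:
  assumes "computable f" shows "decidable (\<lambda>e. f e = 0)"
proof -
  have eq: "rec_nat 1 (\<lambda>_ _. 0) n = (of_bool (n = 0) :: nat)" for n :: nat by (cases n) auto
  have "computable (\<lambda>e. rec_nat 1 (\<lambda>_ _. 0) (f e))"
    by (intro computable_rec computable_const assms)
  then show ?thesis by (simp only: eq decidable_def)
qed

lemma decidable_le: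
  assumes "computable f" "computable g" shows "decidable (\<lambda>e. f e \<le> g e)"
  using decidable_eq_0[OF computable_diff[OF assms]] by simp

lemma decidable_less:
  assumes "computable f" "computable g" shows "decidable (\<lambda>e. f e < g e)"
  using decidable_not[OF decidable_le[OF assms(2,1)]] by (simp add: not_le)

lemma decidable_eq:
  assumes "computable f" "computable g" shows "decidable (\<lambda>e. f e = g e)"
  using decidable_conj[OF decidable_le[OF assms] decidable_le[OF assms(2,1)]]
  by (simp add: eq_iff)

text \<open>In the rules for bounded operators the bound variable becomes variable 0 of the
environment, so the remaining variables are shifted by one.\<close>

lemma computable_sum:
  assumes f: "computable (\<lambda>e. f (e 0) (\<lambda>i. e (Suc i)))" and g: "computable g"
  shows "computable (\<lambda>e. \<Sum>i<g e. f i e)"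
proof -
  have eq: "rec_nat 0 (\<lambda>m b. b + f m e) n = (\<Sum>i<n. f i e)" for n :: nat and e
    by (induction n) auto
  have "computable (\<lambda>e. f (e 0) (\<lambda>i. e (Suc (Suc i))))"
    using computable_rename[OF f, of "case_nat 0 (\<lambda>i. Suc (Suc i))"] by simp
  then have "computable (\<lambda>e. rec_nat 0 (\<lambda>m b. b + f m e) (g e))"
    by (intro computable_rec computable_const computable_var computable_add g)
  then show ?thesis by (simp only: eq)
qed

lemma computable_card:
  assumes "decidable (\<lambda>e. Q (e 0) (\<lambda>i. e (Suc i)))" and "computable g"
  shows "computable (\<lambda>e. card {i. i < g e \<and> Q i e})"
proof -
  have "computable (\<lambda>e. \<Sum>i<g e. of_bool (Q i e))"
    using assms by (intro computable_sum) (simp_all add: decidable_def)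
  moreover have "(\<Sum>i<n. of_bool (Q i e)) = card {i. i < n \<and> Q i e}" for n e
    by (simp add: Int_def)
  ultimately show ?thesis by simp
qed

lemma decidable_bex:
  assumes "decidable (\<lambda>e. Q (e 0) (\<lambda>i. e (Suc i)))" and "computable g"
  shows "decidable (\<lambda>e. \<exists>i<g e. Q i e)"
proof -
  have "decidable (\<lambda>e. \<not> card {i. i < g e \<and> Q i e} = 0)"
    by (intro decidable_not decidable_eq_0 computable_card assms)
  then show ?thesis by simp
qed

section \<open>Coding of finite environments\<close>

lemma computable_prod_encode:
  assumes "computable f" "computable g"
  shows "computable (\<lambda>e. prod_encode (f e, g e))"
proof -
  have eq: "rec_nat 0 (\<lambda>m b. b + Suc m) n = triangle n" for n by (induction n) auto
  have "computable (\<lambda>e. rec_nat 0 (\<lambda>m b. b + Suc m) (f e + g e) + f e)"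
    by (intro computable_rec computable_const computable_var computable_add computable_Suc assms)
  then show ?thesis by (simp only: eq prod_encode_def case_prod_conv)
qed

text \<open>Both components of a pair are at most its code, so decoding is a bounded search, written
  as a sum in which only the right index contributes.\<close>

lemma computable_fst_prod_decode:
  assumes "computable f"
  shows "computable (\<lambda>e. fst (prod_decode (f e)))"
proof -
  have "(\<Sum>i<Suc n. if \<exists>j<Suc n. prod_encode (i, j) = n then i else 0) = fst (prod_decode n)" for n
  proof -
    obtain a b where n: "n = prod_encode (a, b)" by (metis prod_decode_inverse surj_pair)
    have "(if \<exists>j<Suc n. prod_encode (i, j) = n then i else 0) = (if i = a then a else 0)" for i
      using le_prod_encode_2[of b a] by (auto simp: n prod_encode_eq less_Suc_eq_le)
    then show ?thesis using le_prod_encode_1[of a b] by (simp add: n less_Suc_eq_le del: sum.lessThan_Suc)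
  qed
  moreover have "computable (\<lambda>e. \<Sum>i<Suc (f e). if \<exists>j<Suc (f e). prod_encode (i, j) = f e then i else 0)"
    by (intro computable_sum computable_if decidable_bex decidable_eq computable_prod_encode
        computable_Suc computable_const computable_var assms
        computable_rename[OF assms])
  ultimately show ?thesis by simp
qed

lemma computable_snd_prod_decode:
  assumes "computable f"
  shows "computable (\<lambda>e. snd (prod_decode (f e)))"
proof -
  have "(\<Sum>j<Suc n. if \<exists>i<Suc n. prod_encode (i, j) = n then j else 0) = snd (prod_decode n)" for n
  proof -
    obtain a b where n: "n = prod_encode (a, b)" by (metis prod_decode_inverse surj_pair)
    have "(if \<exists>i<Suc n. prod_encode (i, j) = n then j else 0) = (if j = b then b else 0)" for j
      using le_prod_encode_1[of a b] by (auto simp: n prod_encode_eq less_Suc_eq_le)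
    then show ?thesis using le_prod_encode_2[of b a] by (simp add: n less_Suc_eq_le del: sum.lessThan_Suc)
  qed
  moreover have "computable (\<lambda>e. \<Sum>j<Suc (f e). if \<exists>i<Suc (f e). prod_encode (i, j) = f e then j else 0)"
    by (intro computable_sum computable_if decidable_bex decidable_eq computable_prod_encode
        computable_Suc computable_const computable_var assms
        computable_rename[OF assms])
  ultimately show ?thesis by simp
qed

fun env_encode :: "nat \<Rightarrow> (nat \<Rightarrow> nat) \<Rightarrow> nat" where
  "env_encode 0 e = 0"
| "env_encode (Suc n) e = prod_encode (e 0, env_encode n (\<lambda>i. e (Suc i)))"

text \<open>Decoding is total: every number yields a value for every variable, but only the first
  \<open>n\<close> components of \<open>env_encode n e\<close> are guaranteed.\<close>

fun env_decode :: "nat \<Rightarrow> nat \<Rightarrow> nat" where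
  "env_decode v 0 = fst (prod_decode v)"
| "env_decode v (Suc i) = env_decode (snd (prod_decode v)) i"

lemma env_decode_encode: "i < n \<Longrightarrow> env_decode (env_encode n e) i = e i"
proof (induction n arbitrary: i e)
  case (Suc n)
  then show ?case by (cases i) auto
qed simp

lemma env_encode_cong: "(\<And>i. i < n \<Longrightarrow> e i = e' i) \<Longrightarrow> env_encode n e = env_encode n e'"
proof (induction n arbitrary: e e')
  case (Suc n)
  from Suc.prems[of 0] Suc.IH[of "\<lambda>i. e (Suc i)" "\<lambda>i. e' (Suc i)"] Suc.prems show ?case by simp
qed simp

lemma computable_env_encode:
  "(\<And>i. computable (\<lambda>e. F e i)) \<Longrightarrow> computable (\<lambda>e. env_encode n (F e))"
proof (induction n arbitrary: F)
  case (Suc n)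
  have "computable (\<lambda>e. env_encode n (\<lambda>i. F e (Suc i)))" by (rule Suc.IH) (rule Suc.prems)
  then show ?case by (simp add: computable_prod_encode Suc.prems)
qed (simp add: computable_0)

lemma computable_env_decode: "computable f \<Longrightarrow> computable (\<lambda>e. env_decode (f e) i)"
  by (induction i arbitrary: f) (simp_all add: computable_fst_prod_decode computable_snd_prod_decode)

section \<open>Simulation of a fixed register machine\<close>

text \<open>A configuration is an environment with the program counter as variable 0 and
register r as variable r + 1.\<close>

definition config_env :: "config \<Rightarrow> nat \<Rightarrow> nat" where
  "config_env c = case_nat (fst c) (snd c)"

fun instr_env :: "instr \<Rightarrow> (nat \<Rightarrow> nat) \<Rightarrow> nat \<Rightarrow> nat" where
  "instr_env (Inc r j) e i =
     (if i = 0 then j else if i = Suc r then Suc (e (Suc r)) else e i)"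
| "instr_env (Dec r j k) e i =
     (if e (Suc r) = 0 then (if i = 0 then k else e i)
      else (if i = 0 then j else if i = Suc r then e (Suc r) - 1 else e i))"

definition step_env :: "prog \<Rightarrow> (nat \<Rightarrow> nat) \<Rightarrow> nat \<Rightarrow> nat" where
  "step_env P e i = (if e 0 < length P then instr_env (P ! e 0) e i else e i)"

lemma config_env_step: "config_env (step P c) = step_env P (config_env c)"
  by (cases c) (auto simp: config_env_def step_env_def fun_eq_iff split: instr.split nat.split)

lemma computable_instr_env:
  assumes "\<And>i. computable (\<lambda>e. X e i)"
  shows "computable (\<lambda>e. instr_env I (X e) i)"
proof (cases I)
  case (Inc r j)
  show ?thesis
    unfolding Inc instr_env.simps
    by (intro computable_if decidable_const computable_const computable_Suc assms)
next
  case (Dec r j k)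
  show ?thesis
    unfolding Dec instr_env.simps
    by (intro computable_if decidable_const decidable_eq_0 computable_const computable_diff assms)
qed

text \<open>\<open>P\<close> is fixed, so the instruction lookup is a finite case distinction on the
  program counter, built up by induction on the number \<open>L\<close> of cases.\<close>

lemma computable_step_env:
  assumes X: "\<And>i. computable (\<lambda>e. X e i)"
  shows "computable (\<lambda>e. step_env P (X e) i)"
proof -
  have "computable (\<lambda>e. if X e 0 < L then instr_env (P ! X e 0) (X e) i else X e i)" for L
  proof (induction L)
    case 0
    show ?case using X by simp
  next
    case (Suc L)
    have "computable (\<lambda>e. if X e 0 = L then instr_env (P ! L) (X e) i
        else if X e 0 < L then instr_env (P ! X e 0) (X e) i else X e i)"
      by (intro computable_if decidable_eq computable_instr_env X computable_const Suc)
    then show ?case by (rule back_subst[of computable]) (auto simp: less_Suc_eq)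
  qed
  then show ?thesis by (simp add: step_env_def)
qed

text \<open>A program mentions finitely many registers, so long enough initial segments of
  configurations evolve on their own. This makes a finite code of the configuration
  sufficient.\<close>

lemma step_env_local:
  "\<exists>M. \<forall>N\<ge>M. \<forall>e e'. (\<forall>i<N. e i = e' i) \<longrightarrow> (\<forall>i<N. step_env P e i = step_env P e' i)"
proof -
  define reg where "reg = case_instr (\<lambda>r j. r) (\<lambda>r j k. r)"
  obtain M where M: "I \<in> set P \<Longrightarrow> reg I < M" for I
    using finite_nat_set_iff_bounded[of "reg ` set P"] by auto
  show ?thesis
  proof (intro exI[of _ "Suc M"] allI impI)
    fix N i and e e' :: "nat \<Rightarrow> nat"
    assume N: "N \<ge> Suc M" and eq: "\<forall>i<N. e i = e' i" and i: "i < N"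
    have "instr_env I e i = instr_env I e' i" if "I \<in> set P" for I
      using M[OF that] N eq i by (cases I) (auto simp: reg_def)
    then show "step_env P e i = step_env P e' i" using N eq i by (auto simp: step_env_def)
  qed
qed

lemma computable_config:
  assumes f: "computable f" and g: "computable g" and h: "computable h"
  shows "computable (\<lambda>e. config_env ((step P ^^ h e) (init [f e, g e])) i)"
proof -
  obtain M where M: "\<And>N e e'. N \<ge> M \<Longrightarrow> \<forall>i<N. e i = e' i \<Longrightarrow>
      \<forall>i<N. step_env P e i = step_env P e' i"
    using step_env_local[of P] by metis
  \<comment> \<open>Long enough to be closed under steps and to contain the requested component
    \<open>i\<close>.\<close>
  define N where "N = Suc (max M i)"
  have iN: "i < N" and MN: "M \<le> N" by (simp_all add: N_def)
  define c0 where "c0 = (\<lambda>e. case_nat 0 (case_nat (f e) (case_nat (g e) (\<lambda>_. 0 :: nat))))"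
  have c0: "config_env (init [f e, g e]) = c0 e" for e
    by (auto simp: config_env_def init_def c0_def fun_eq_iff nth_Cons split: nat.split)
  have comp_c0: "computable (\<lambda>e. c0 e i)" for i
  proof -
    consider "i = 0" | "i = Suc 0" | "i = Suc (Suc 0)" | j where "i = Suc (Suc (Suc j))"
      by (metis not0_implies_Suc)
    then show ?thesis
      by cases (simp_all only: c0_def nat.case f g computable_const)
  qed
  have "rec_nat (env_encode N (c0 e)) (\<lambda>m v. env_encode N (step_env P (env_decode v))) t =
      env_encode N (config_env ((step P ^^ t) (init [f e, g e])))" for t e
  proof (induction t)
    case (Suc t)
    let ?e = "config_env ((step P ^^ t) (init [f e, g e]))"
    have "\<forall>i<N. step_env P (env_decode (env_encode N ?e)) i = step_env P ?e i"
      by (rule M[OF MN]) (simp add: env_decode_encode)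
    then have "env_encode N (step_env P (env_decode (env_encode N ?e))) =
        env_encode N (step_env P ?e)"
      by (intro env_encode_cong) blast
    then show ?case by (simp only: nat.rec funpow.simps comp_apply Suc config_env_step)
  qed (simp only: nat.rec funpow.simps id_apply c0)
  then have "config_env ((step P ^^ h e) (init [f e, g e])) i = env_decode (rec_nat
      (env_encode N (c0 e)) (\<lambda>m v. env_encode N (step_env P (env_decode v))) (h e)) i" for e
    using env_decode_encode[of i N] by (simp only: iN)
  moreover have "computable (\<lambda>e. env_decode (rec_nat
      (env_encode N (c0 e)) (\<lambda>m v. env_encode N (step_env P (env_decode v))) (h e)) i)"
    by (intro computable_env_decode computable_rec computable_env_encode comp_c0 h
        computable_step_env computable_var)
  ultimately show ?thesis by simp
qed

lemma decidable_halts_within: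
  assumes "computable f" "computable g" "computable h"
  shows "decidable (\<lambda>e. halts_within P [f e, g e] (h e))"
  using decidable_le[OF computable_const computable_config[OF assms, of P 0], of "length P"]
  by (simp add: config_env_def halts_within_def halted_def)

lemma computable_register_0:
  assumes "computable f" "computable g" "computable h"
  shows "computable (\<lambda>e. snd ((step P ^^ h e) (init [f e, g e])) 0)"
  using computable_config[OF assms, of P 1] by (simp add: config_env_def)

section \<open>Computations with binary strings\<close>

lemma enc_append: "enc (xs @ ys) = enc xs + 2 ^ length xs * enc ys"
  by (induction xs) (auto simp: algebra_simps)

lemma enc_replicate_False: "enc (replicate n False) = 2 ^ n - 1"
proof (induction n)
  case (Suc n)
  have "(2::nat) ^ n \<noteq> 0" by simp
  then show ?case using Suc by (simp, arith)
qed simp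

lemma enc_lower_bound: "2 ^ length xs \<le> Suc (enc xs)"
  by (induction xs) auto

lemma enc_upper_bound: "Suc (enc xs) < 2 ^ Suc (length xs)"
  by (induction xs) auto

lemma inj_enc: "inj enc"
proof (rule injI)
  show "enc xs = enc ys \<Longrightarrow> xs = ys" for xs ys
  proof (induction xs arbitrary: ys)
    case Nil
    then show ?case by (cases ys) (auto split: if_splits)
  next
    case (Cons b xs)
    then obtain c zs where ys: "ys = c # zs" by (cases ys) (auto split: if_splits)
    have "b = c" using Cons.prems ys by (auto split: if_splits) presburger+
    then show ?case using Cons ys by simp
  qed
qed

lemma surj_enc: "surj enc"
proof -
  have "\<exists>xs. enc xs = n" for n
  proof (induction n rule: less_induct)
    case (less n)
    show ?case
    proof (cases "n = 0")
      case True
      then show ?thesis by (intro exI[of _ "[]"]) simp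
    next
      case False
      then have "(n - 1) div 2 < n" by linarith
      then obtain xs where "enc xs = (n - 1) div 2" using less by blast
      \<comment> \<open>The parity of \<open>n\<close> forces the first digit: 2 for even
        \<open>n\<close>, 1 for odd \<open>n\<close>.\<close>
      then have "enc (even n # xs) = n" using False by simp presburger
      then show ?thesis ..
    qed
  qed
  then show ?thesis by (metis surjI)
qed

definition dec :: "nat \<Rightarrow> bool list" where
  "dec = inv enc"

lemma enc_dec [simp]: "enc (dec n) = n"
  by (simp add: dec_def surj_f_inv_f surj_enc)

lemma dec_enc [simp]: "dec (enc xs) = xs"
  by (simp add: dec_def inj_enc)

text \<open>By the two bounds on \<open>enc\<close>, \<open>l < length xs\<close> holds exactly if
  \<open>2 ^ Suc l \<le> Suc (enc xs)\<close>, and counting such \<open>l\<close> gives the length.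
  String-valued functions are treated through their codes throughout.\<close>

lemma computable_length:
  assumes "computable (\<lambda>e. enc (F e))"
  shows "computable (\<lambda>e. length (F e))"
proof -
  have "{l. l < enc xs \<and> 2 ^ Suc l \<le> Suc (enc xs)} = {..<length xs}" for xs
  proof (intro set_eqI iffI)
    fix l assume "l \<in> {l. l < enc xs \<and> 2 ^ Suc l \<le> Suc (enc xs)}"
    then have "(2::nat) ^ Suc l < 2 ^ Suc (length xs)"
      using le_less_trans[OF _ enc_upper_bound[of xs]] by blast
    then show "l \<in> {..<length xs}"
      using power_less_imp_less_exp[of "2::nat" "Suc l" "Suc (length xs)"] by simp
  next
    fix l assume "l \<in> {..<length xs}"
    then have "Suc l \<le> length xs" by simp
    moreover from this have "(2::nat) ^ Suc l \<le> 2 ^ length xs"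
      by (rule power_increasing) simp
    ultimately have "2 ^ Suc l \<le> Suc (enc xs)" using enc_lower_bound[of xs] by linarith
    moreover have "Suc l < 2 ^ Suc l" by (rule less_exp)
    ultimately show "l \<in> {l. l < enc xs \<and> 2 ^ Suc l \<le> Suc (enc xs)}"
      by (intro CollectI conjI) linarith+
  qed
  then have "length xs = card {l. l < enc xs \<and> 2 ^ Suc l \<le> Suc (enc xs)}" for xs by simp
  moreover have "computable (\<lambda>e. card {l. l < enc (F e) \<and> 2 ^ Suc l \<le> Suc (enc (F e))})"
    by (intro computable_card decidable_conj decidable_less decidable_le computable_power
        computable_const computable_Suc computable_var computable_rename[OF assms] assms)
  ultimately show ?thesis by (simp only:)
qed

lemma computable_enc_dec: "computable f \<Longrightarrow> computable (\<lambda>e. enc (dec (f e)))"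
  by simp

lemma computable_enc_append:
  assumes "computable (\<lambda>e. enc (F e))" "computable (\<lambda>e. enc (G e))"
  shows "computable (\<lambda>e. enc (F e @ G e))"
  unfolding enc_append
  by (intro computable_add computable_mult computable_power computable_const computable_length assms)

lemma computable_enc_Cons:
  assumes "decidable Q" "computable (\<lambda>e. enc (F e))"
  shows "computable (\<lambda>e. enc (Q e # F e))"
  unfolding enc.simps
  by (intro computable_add computable_mult computable_const computable_if assms)

lemma computable_enc_Nil: "computable (\<lambda>e. enc [])"
  by (simp add: computable_0)

lemma computable_enc_replicate_False:
  "computable f \<Longrightarrow> computable (\<lambda>e. enc (replicate (f e) False))"
  unfolding enc_replicate_False
  by (intro computable_diff computable_power computable_const)

lemmas computable_intros =
  computable_var computable_const computable_Suc computable_add computable_mult computable_power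
  computable_diff computable_of_bool computable_prod_encode computable_env_decode
  computable_length computable_enc_dec computable_enc_append computable_enc_Cons
  computable_enc_Nil computable_enc_replicate_False computable_register_0
  decidable_const decidable_not decidable_conj decidable_le decidable_less decidable_eq
  decidable_halts_within

section \<open>Self-delimiting inputs, shortest programs and machines by search\<close>

lemma replicate_False_True_eq_iff:
  "replicate d False @ True # u = replicate d' False @ True # u' \<longleftrightarrow> d = d' \<and> u = u'"
proof (induction d arbitrary: d')
  case 0
  then show ?case by (cases d') auto
next
  case (Suc d)
  then show ?case by (cases d') auto
qed

text \<open>Two prefixes of one string are comparable, and prefix-freeness makes comparable halting
  inputs equal. So a halting prefix can be split off without a delimiter.\<close>

lemma prefix_free_cond_unique:
  assumes "prefix_free_cond P" "halts P [enc q, y]" "halts P [enc q', y]" "q @ u = q' @ u'"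
  shows "q = q'"
  using assms unfolding prefix_free_cond_def append_eq_append_conv2 by (metis append_Nil2)

lemma Inf_enat_le_imp_ex:
  assumes "Inf A \<le> enat m"
  shows "\<exists>a\<in>A. a \<le> enat m"
  using assms by (auto simp: Inf_enat_def split: if_splits intro: LeastI)

lemma C_le_imp_ex:
  assumes "C U x \<le> enat m"
  shows "\<exists>p. length p \<le> m \<and> out U [enc p] = Some (enc x)"
  using Inf_enat_le_imp_ex[OF assms[unfolded C_def]] by auto

lemma optimal_program:
  assumes "\<forall>x. C U x \<le> C V x + enat c" and "out V [enc w] = Some x"
  shows "\<exists>p. length p \<le> length w + c \<and> out U [enc p] = Some x"
proof -
  have "C V (dec x) \<le> enat (length w)"
    using assms(2) unfolding C_def by (intro Inf_lower) auto
  then have "C U (dec x) \<le> enat (length w) + enat c"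
    using assms(1) add_right_mono order_trans by blast
  then show ?thesis using C_le_imp_ex[of U "dec x" "length w + c"] by simp
qed

text \<open>\<open>the_enat\<close> is meaningful only on finite values. The prefix-free machine
  that reads \<open>s\<close> zeros followed by a one and prints \<open>s\<close> gives every
  \<open>x\<close> a program, so optimality makes \<open>Kc P x y\<close> finite, and the minimum is
  attained.\<close>

lemma Kc_program:
  assumes "optimal_pf P"
  shows "\<exists>q. out P [enc q, y] = Some x \<and> length q = the_enat (Kc P x y)"
proof -
  define code where "code s = replicate s False @ [True]" for s
  have code_eq: "code s = code s' \<longleftrightarrow> s = s'" for s s'
    by (simp only: code_def replicate_False_True_eq_iff simp_thms)
  have "computable (\<lambda>e. of_bool (e (Suc 0) = enc (code (e 0))))"
    unfolding code_def by (intro computable_intros)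
  from search_machine[OF this computable_var[of 0]]
  obtain V where V: "\<And>a y. out V [a, y] = (if \<exists>s. a = enc (code s)
      then Some (LEAST s. a = enc (code s)) else None)"
    by blast
  have halts: "halts V [enc p, y] \<longleftrightarrow> (\<exists>s. p = code s)" for p y
    using V[of "enc p" y] unfolding inj_eq[OF inj_enc] out_def by (auto split: if_splits)
  have "prefix_free_cond V"
    unfolding prefix_free_cond_def halts
  proof (intro allI impI, elim exE)
    fix p r s s' assume "p = code s" "p @ r = code s'"
    then have "replicate s False @ True # r = replicate s' False @ True # []"
      by (simp add: code_def)
    then show "r = []" by (simp only: replicate_False_True_eq_iff)
  qed
  then obtain c where "Kc P x y \<le> Kc V x y + enat c"
    using assms unfolding optimal_pf_def by blast
  moreover have "out V [enc (code x), y] = Some x"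
    unfolding V inj_eq[OF inj_enc] code_eq by (auto intro: Least_equality)
  then have "Kc V x y \<le> enat (length (code x))"
    unfolding Kc_def by (intro Inf_lower) blast
  ultimately have "Kc P x y \<le> enat (length (code x)) + enat c"
    using add_right_mono order_trans by blast
  then have "Kc P x y \<noteq> \<infinity>" by (cases "Kc P x y") simp_all
  then obtain m where m: "Kc P x y = enat m" by blast
  then obtain q where q: "out P [enc q, y] = Some x" "length q \<le> m"
    using Inf_enat_le_imp_ex[OF eq_refl[OF m[unfolded Kc_def]]] by auto
  then have "enat m \<le> enat (length q)"
    unfolding m[symmetric] Kc_def by (intro Inf_lower) auto
  then show ?thesis using q m by (intro exI[of _ q]) auto
qed

text \<open>\<open>v\<close> lists the output and the hidden witnesses; \<open>V\<close> searches
  the codes of such lists. By \<open>local\<close>, coding the first \<open>N\<close> components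
  loses nothing. The list found may differ from an expected one, so \<open>R\<close> itself must
  determine whatever is used later.\<close>

lemma choice_machine:
  assumes R: "decidable (\<lambda>e. R (env_decode (e 0)) (e (Suc 0)))"
    and local: "\<And>v v' a. \<forall>i<N. v i = v' i \<Longrightarrow> R v a = R v' a"
  shows "\<exists>V. \<forall>a. (\<exists>v. R v a) \<longrightarrow> (\<exists>v. R v a \<and> out V [a] = Some (v 0))"
proof -
  have "\<exists>V. \<forall>a y. out V [a, y] = (if \<exists>s. R (env_decode s) a
      then Some (env_decode (LEAST s. R (env_decode s) a) 0) else None)"
    using R by (intro search_machine[of "\<lambda>s a y. R (env_decode s) a" "\<lambda>s. env_decode s 0"]
        computable_intros) (simp add: decidable_def)
  then obtain V where V: "\<And>a y. out V [a, y] = (if \<exists>s. R (env_decode s) a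
      then Some (env_decode (LEAST s. R (env_decode s) a) 0) else None)"
    by blast
  have "\<exists>v. R v a \<and> out V [a] = Some (v 0)" if "R v a" for a v
  proof -
    have "R (env_decode (env_encode N v)) a"
      using that local[of v "env_decode (env_encode N v)"] by (simp add: env_decode_encode)
    then have ex: "\<exists>s. R (env_decode s) a" by blast
    then have "R (env_decode (LEAST s. R (env_decode s) a)) a" by (rule LeastI_ex)
    then show ?thesis using ex by (auto simp: out_single V)
  qed
  then show ?thesis by blast
qed

section \<open>Time-bounded search through all short programs\<close>

definition halting_within :: "prog \<Rightarrow> nat \<Rightarrow> nat \<Rightarrow> bool list set" where
  "halting_within U n t = {p. length p \<le> n \<and> halts_within U [enc p] t}"

definition outputs_within :: "prog \<Rightarrow> nat \<Rightarrow> nat \<Rightarrow> nat set" where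
  "outputs_within U n t = (\<lambda>p. snd ((step U ^^ t) (init [enc p])) 0) ` halting_within U n t"

lemma finite_length_le: "finite {p :: bool list. length p \<le> n \<and> Q p}"
  using finite_lists_length_le[of "UNIV :: bool set" n] by (auto elim: rev_finite_subset)

lemma finite_halting_within: "finite (halting_within U n t)"
  unfolding halting_within_def by (rule finite_length_le)

lemma finite_outputs_within: "finite (outputs_within U n t)"
  by (simp add: outputs_within_def finite_halting_within)

text \<open>Codes of strings of length at most \<open>n\<close> are bounded, which makes the set
  accessible to counting and bounded search.\<close>

lemma enc_halting_within:
  "enc ` halting_within U n t =
    {i. i < 2 ^ Suc n \<and> length (dec i) \<le> n \<and> halts_within U [i, 0] t}"
proof -
  have "enc p < 2 ^ Suc n" if "length p \<le> n" for p
  proof -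
    have "enc p < 2 ^ Suc (length p)" using enc_upper_bound[of p] by linarith
    also have "(2::nat) ^ Suc (length p) \<le> 2 ^ Suc n"
      using that by (intro power_increasing) auto
    finally show ?thesis .
  qed
  then show ?thesis
    unfolding halting_within_def
    by (auto simp: halts_within_def init_single simp del: power_Suc intro!: image_eqI[of _ enc "dec _"])
qed

lemma computable_card_halting_within:
  assumes f: "computable f" and g: "computable g"
  shows "computable (\<lambda>e. card (halting_within U (f e) (g e)))"
proof -
  have "card (halting_within U n t) = card (enc ` halting_within U n t)" for n t
    using inj_enc by (metis card_image inj_on_subset subset_UNIV)
  then show ?thesis
    unfolding enc_halting_within
    by (simp only:) (intro computable_card computable_intros computable_rename[OF f]
        computable_rename[OF g] f)
qed

lemma decidable_outputs_within:
  assumes f: "computable f" and g: "computable g" and h: "computable h"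
  shows "decidable (\<lambda>e. f e \<in> outputs_within U (g e) (h e))"
proof -
  have "x \<in> outputs_within U n t \<longleftrightarrow> (\<exists>i<2 ^ Suc n. length (dec i) \<le> n \<and>
      halts_within U [i, 0] t \<and> snd ((step U ^^ t) (init [i, 0])) 0 = x)" for x n t
  proof -
    have "outputs_within U n t = (\<lambda>i. snd ((step U ^^ t) (init [i, 0])) 0) ` enc ` halting_within U n t"
      by (simp add: outputs_within_def image_image init_single)
    then show ?thesis unfolding enc_halting_within by auto
  qed
  then show ?thesis
    by (simp only:) (intro decidable_bex computable_intros computable_rename[OF f]
        computable_rename[OF g] computable_rename[OF h] g)
qed

text \<open>Had \<open>p\<close> halted within \<open>t\<close> steps, its frozen register 0 would
  show \<open>x\<close> at time \<open>t\<close>. This turns freshness of an output into a lower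
  bound on running time.\<close>

lemma not_outputs_within_imp_runtime:
  assumes "out U [enc p] = Some x" "length p \<le> n" "x \<notin> outputs_within U n t"
  shows "halts U [enc p] \<and> t < runtime U [enc p]"
proof -
  obtain s where s: "halts_within U [enc p] s" "snd ((step U ^^ s) (init [enc p])) 0 = x"
    using assms(1) unfolding out_eq_Some_iff by blast
  have "\<not> halts_within U [enc p] t"
  proof
    assume t: "halts_within U [enc p] t"
    have "(step U ^^ t) (init [enc p]) = (step U ^^ s) (init [enc p])"
      using funpow_step_stable[of U s "init [enc p]" t] funpow_step_stable[of U t "init [enc p]" s]
        s(1) t unfolding halts_within_def by (metis nle_le)
    then show False using assms s(2) t
      by (force simp: outputs_within_def halting_within_def)
  qed
  then show ?thesis using s(1) by (auto simp: halts_within_iff_runtime)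
qed

section \<open>The two machines\<close>

text \<open>Among the strings of length \<open>|r|\<close>, \<open>r\<close> has position \<open>Suc (enc r) - 2 ^ length r\<close>.\<close>

lemma counting_machine:
  assumes P: "prefix_free_cond P"
  shows "\<exists>V. \<forall>d q r n w s. w = replicate d False @ True # q @ r \<longrightarrow>
    out P [enc q, 0] = Some n \<longrightarrow> s = Suc (enc r) - 2 ^ length r \<longrightarrow>
    (\<exists>T. s * 2 ^ (n - (length r - 1)) \<le> card (halting_within U n T)) \<longrightarrow>
    (\<exists>x T. out V [enc w] = Some x \<and> s * 2 ^ (n - (length r - 1)) \<le> card (halting_within U n T) \<and>
      x \<notin> outputs_within U (length w + d) T)"
proof -
  text \<open>The components of \<open>v\<close> are the output, \<open>d\<close>, \<open>q\<close>, \<open>r\<close>, \<open>n\<close>, the time bound for \<open>U\<close>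
    and the time bound for \<open>P\<close>.\<close>
  define R where "R v a \<longleftrightarrow>
      enc (dec a) = enc (replicate (v 1) False @ True # dec (v 2) @ dec (v 3)) \<and>
      halts_within P [v 2, 0] (v 6) \<and> snd ((step P ^^ v 6) (init [v 2, 0])) 0 = v 4 \<and>
      (Suc (enc (dec (v 3))) - 2 ^ length (dec (v 3))) * 2 ^ (v 4 - (length (dec (v 3)) - 1))
        \<le> card (halting_within U (v 4) (v 5)) \<and>
      v 0 \<notin> outputs_within U (length (dec a) + v 1) (v 5)" for v :: "nat \<Rightarrow> nat" and a
  have "decidable (\<lambda>e. R (env_decode (e 0)) (e (Suc 0)))"
    unfolding R_def
    by (intro computable_intros computable_card_halting_within decidable_outputs_within)
  moreover have "R v a = R v' a" if "\<forall>i<7. v i = v' i" for v v' a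
    using that[rule_format, of 0] that[rule_format, of 1] that[rule_format, of 2]
      that[rule_format, of 3] that[rule_format, of 4] that[rule_format, of 5] that[rule_format, of 6]
    by (simp add: R_def)
  ultimately obtain V where V: "\<And>a. \<exists>v. R v a \<Longrightarrow> \<exists>v. R v a \<and> out V [a] = Some (v 0)"
    using choice_machine[of R 7] by blast
  have "\<exists>x T. out V [enc w] = Some x \<and>
      s * 2 ^ (n - (length r - 1)) \<le> card (halting_within U n T) \<and>
      x \<notin> outputs_within U (length w + d) T"
    if w: "w = replicate d False @ True # q @ r" and n: "out P [enc q, 0] = Some n"
      and s: "s = Suc (enc r) - 2 ^ length r"
      and T: "s * 2 ^ (n - (length r - 1)) \<le> card (halting_within U n T)"
    for d q r n w s T
  proof -
    obtain t where t: "halts_within P [enc q, 0] t" "snd ((step P ^^ t) (init [enc q, 0])) 0 = n"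
      using n unfolding out_eq_Some_iff by blast
    obtain x where x: "x \<notin> outputs_within U (length w + d) T"
      using ex_new_if_finite[OF infinite_UNIV_nat finite_outputs_within] by blast
    define v where "v = (!) [x, d, enc q, enc r, n, T, t]"
    have v: "v 0 = x" "v 1 = d" "v 2 = enc q" "v 3 = enc r" "v 4 = n" "v 5 = T" "v 6 = t"
      by (simp_all add: v_def)
    have "R v (enc w)"
      using w t s T x unfolding R_def v by simp
    \<comment> \<open>This \<open>v\<close> need not be the one built above. The unary prefix fixes
      \<open>d\<close>, prefix-freeness fixes \<open>q\<close>, and \<open>n\<close> and
      \<open>r\<close> follow; only the times and the output remain open.\<close>
    then obtain v where v: "R v (enc w)" "out V [enc w] = Some (v 0)" using V by blast
    have "w = replicate (v 1) False @ True # dec (v 2) @ dec (v 3)"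
      using v(1) by (simp add: R_def inj_eq[OF inj_enc])
    then have d: "v 1 = d" and qr: "q @ r = dec (v 2) @ dec (v 3)"
      using w by (simp_all add: replicate_False_True_eq_iff)
    have n': "out P [v 2, 0] = Some (v 4)"
      using v(1) unfolding out_eq_Some_iff R_def by blast
    have "q = dec (v 2)"
      using prefix_free_cond_unique[OF P _ _ qr, of 0] n n'
      by (simp add: out_def split: if_splits)
    then have "v 4 = n" "dec (v 3) = r" using n n' qr by auto
    then show ?thesis using v d s unfolding R_def
      by - (rule exI[of _ "v 0"], rule exI[of _ "v 5"], simp)
  qed
  then show ?thesis by blast
qed

text \<open>The input has only one parsing: the unary prefix gives \<open>d\<close>, the next bit
  \<open>b\<close>, and with the length this gives \<open>n\<close>; prefix-freeness given
  \<open>n\<close> isolates \<open>q\<close> and hence \<open>k\<close>; the length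
  \<open>Suc n - k\<close> of \<open>z\<close> separates \<open>p\<close> from \<open>z\<close>.
  Running \<open>U\<close> on \<open>p\<close> supplies the time bound. In the output pair
  \<open>z\<close> stays recoverable while \<open>y\<close> is free to ensure freshness.\<close>

lemma busy_machine:
  assumes P: "prefix_free_cond P"
  shows "\<exists>V. \<forall>d b q p z n k w. w = replicate d False @ True # b # q @ p @ z \<longrightarrow>
    n = length w + d + of_bool b \<longrightarrow> out P [enc q, n] = Some k \<longrightarrow>
    length z = Suc n - k \<longrightarrow> halts U [enc p] \<longrightarrow>
    (\<exists>y T. halts_within U [enc p] T \<and> out V [enc w] = Some (prod_encode (enc z, y)) \<and>
      prod_encode (enc z, y) \<notin> outputs_within U n T)"
proof -
  text \<open>The components of \<open>v\<close> are the output, \<open>d\<close>, \<open>b\<close>, \<open>q\<close>, \<open>p\<close>, \<open>z\<close>, \<open>y\<close>, \<open>k\<close>, the running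
    time of \<open>U\<close> and the running time of \<open>P\<close>.\<close>
  define len where "len v a = length (dec a) + v 1 + of_bool (v 2 = 1)" for v :: "nat \<Rightarrow> nat" and a
  define R where "R v a \<longleftrightarrow>
      enc (dec a) = enc (replicate (v 1) False @ True # (v 2 = 1) # dec (v 3) @ dec (v 4) @ dec (v 5)) \<and>
      halts_within P [v 3, len v a] (v 9) \<and>
      snd ((step P ^^ v 9) (init [v 3, len v a])) 0 = v 7 \<and>
      length (dec (v 5)) = Suc (len v a) - v 7 \<and>
      halts_within U [v 4, 0] (v 8) \<and>
      v 0 = prod_encode (v 5, v 6) \<and>
      v 0 \<notin> outputs_within U (len v a) (v 8)" for v :: "nat \<Rightarrow> nat" and a
  have "decidable (\<lambda>e. R (env_decode (e 0)) (e (Suc 0)))"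
    unfolding R_def len_def
    by (intro computable_intros decidable_outputs_within)
  moreover have "R v a = R v' a" if "\<forall>i<10. v i = v' i" for v v' a
    using that[rule_format, of 0] that[rule_format, of 1] that[rule_format, of 2]
      that[rule_format, of 3] that[rule_format, of 4] that[rule_format, of 5]
      that[rule_format, of 6] that[rule_format, of 7] that[rule_format, of 8]
      that[rule_format, of 9]
    by (simp add: R_def len_def)
  ultimately obtain V where V: "\<And>a. \<exists>v. R v a \<Longrightarrow> \<exists>v. R v a \<and> out V [a] = Some (v 0)"
    using choice_machine[of R 10] by blast
  have "\<exists>y T. halts_within U [enc p] T \<and> out V [enc w] = Some (prod_encode (enc z, y)) \<and>
      prod_encode (enc z, y) \<notin> outputs_within U n T"
    if w: "w = replicate d False @ True # b # q @ p @ z"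
      and n: "n = length w + d + of_bool b" and k: "out P [enc q, n] = Some k"
      and z: "length z = Suc n - k" and p: "halts U [enc p]"
    for d b q p z n k w
  proof -
    obtain t where t: "halts_within P [enc q, n] t" "snd ((step P ^^ t) (init [enc q, n])) 0 = k"
      using k unfolding out_eq_Some_iff by blast
    obtain T where T: "halts_within U [enc p] T" using p unfolding halts_def by blast
    have "infinite (range (\<lambda>y. prod_encode (enc z, y)))"
      by (intro range_inj_infinite) (auto simp: inj_def prod_encode_eq)
    then obtain y where y: "prod_encode (enc z, y) \<notin> outputs_within U n T"
      using finite_outputs_within[of U n T] by (meson finite_subset image_subsetI)
    define v where
      "v = (!) [prod_encode (enc z, y), d, of_bool b, enc q, enc p, enc z, y, k, T, t]"
    have v: "v 0 = prod_encode (enc z, y)" "v 1 = d" "v 2 = of_bool b" "v 3 = enc q" "v 4 = enc p"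
      "v 5 = enc z" "v 6 = y" "v 7 = k" "v 8 = T" "v 9 = t"
      by (simp_all add: v_def)
    have "len v (enc w) = n" unfolding len_def v using n by simp
    then have "R v (enc w)"
      using w t z T y unfolding R_def v by (simp add: halts_within_def init_single)
    then obtain v where v: "R v (enc w)" "out V [enc w] = Some (v 0)" using V by blast
    have "w = replicate (v 1) False @ True # (v 2 = 1) # dec (v 3) @ dec (v 4) @ dec (v 5)"
      using v(1) by (simp add: R_def inj_eq[OF inj_enc])
    then have d: "v 1 = d" and b: "(v 2 = 1) = b"
      and eq: "q @ p @ z = dec (v 3) @ dec (v 4) @ dec (v 5)"
      using w by (simp_all add: replicate_False_True_eq_iff)
    have len: "len v (enc w) = n" unfolding len_def d b using n by simp
    have k': "out P [v 3, n] = Some (v 7)"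
      using v(1) unfolding out_eq_Some_iff R_def len by blast
    have q: "q = dec (v 3)"
      using prefix_free_cond_unique[OF P _ _ eq, of n] k k'
      by (simp add: out_def split: if_splits)
    then have "v 7 = k" using k k' by simp
    then have "length (dec (v 5)) = length z" using v(1) z len by (simp add: R_def)
    then have pz: "p = dec (v 4)" "z = dec (v 5)" using eq q by simp_all
    have "v 0 = prod_encode (v 5, v 6)" "v 0 \<notin> outputs_within U n (v 8)"
      "halts_within U [v 4, 0] (v 8)"
      using v(1) unfolding R_def len by blast+
    then show ?thesis
      using v(2) unfolding pz
      by - (rule exI[of _ "v 6"], rule exI[of _ "v 8"], simp add: halts_within_def init_single)
  qed
  then show ?thesis by blast
qed

section \<open>Busy beaver values, counting and the two bounds\<close>

lemma finite_BB_set: "finite {runtime U [enc p] | p. int (length p) \<le> m \<and> halts U [enc p]}"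
proof -
  have "finite {p. length p \<le> nat m \<and> (halts U [enc p] \<and> 0 \<le> m)}" by (rule finite_length_le)
  then have "finite ((\<lambda>p. runtime U [enc p]) ` {p. length p \<le> nat m \<and> (halts U [enc p] \<and> 0 \<le> m)})"
    by (rule finite_imageI)
  then show ?thesis by (rule rev_finite_subset) force
qed

lemma runtime_le_BB: "int (length p) \<le> m \<Longrightarrow> halts U [enc p] \<Longrightarrow> runtime U [enc p] \<le> BB U m"
  unfolding BB_def by (rule Max_ge) (use finite_BB_set in auto)

lemma less_BB_imp_ex:
  assumes "t < BB U m"
  shows "\<exists>p. int (length p) \<le> m \<and> halts U [enc p] \<and> t < runtime U [enc p]"
proof -
  have "BB U m \<in> insert 0 {runtime U [enc p] | p. int (length p) \<le> m \<and> halts U [enc p]}"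
    unfolding BB_def using finite_BB_set by (intro Max_in) auto
  then show ?thesis using assms by auto
qed

lemma card_length_eq: "card {z :: bool list. length z = m} = 2 ^ m"
  using card_lists_length_eq[of "UNIV :: bool set" m] by simp

lemma card_length_le: "card {p :: bool list. length p \<le> n} < 2 ^ Suc n"
proof -
  have "card {p :: bool list. length p \<le> n} = (\<Sum>i\<le>n. 2 ^ i)"
    using card_lists_length_le[of "UNIV :: bool set" n] by simp
  also have "\<dots> < 2 ^ Suc n" by (induction n) auto
  finally show ?thesis .
qed

lemma few_running_imp_ge_BB:
  assumes "optimal U" "optimal_pf P"
  shows "\<exists>c. \<forall>n k t. k \<le> n \<longrightarrow> still_running U n t \<le> 2 ^ (n - k) \<longrightarrow>
    BB U (int k - int (the_enat (Kc P k n)) - int c) \<le> t"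
proof -
  have "prefix_free_cond P" using assms(2) by (simp add: optimal_pf_def)
  from busy_machine[OF this, of U] obtain V where V: "\<And>d b q p z n k w.
    w = replicate d False @ True # b # q @ p @ z \<Longrightarrow>
    n = length w + d + of_bool b \<Longrightarrow> out P [enc q, n] = Some k \<Longrightarrow>
    length z = Suc n - k \<Longrightarrow> halts U [enc p] \<Longrightarrow>
    \<exists>y T. halts_within U [enc p] T \<and> out V [enc w] = Some (prod_encode (enc z, y)) \<and>
      prod_encode (enc z, y) \<notin> outputs_within U n T"
    by metis
  obtain c where c: "\<forall>x. C U x \<le> C V x + enat c" using assms(1) unfolding optimal_def by blast
  \<comment> \<open>Three bits pay for the marker \<open>True\<close>, the bit \<open>b\<close> and
    the one bit by which \<open>z\<close> exceeds \<open>n - k\<close>; the rest of the constant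
    ensures \<open>2 * c \<le> m\<close>, hence \<open>c \<le> d\<close>.\<close>
  have "BB U (int k - int (the_enat (Kc P k n)) - int (2 * c + 4)) \<le> t"
    if k: "k \<le> n" and few: "still_running U n t \<le> 2 ^ (n - k)" for n k t
  proof (rule ccontr)
    assume "\<not> ?thesis"
    then obtain p where p: "int (length p) \<le> int k - int (the_enat (Kc P k n)) - int (2 * c + 4)"
      "halts U [enc p]" "t < runtime U [enc p]"
      using less_BB_imp_ex[of t U] by (auto simp: not_le)
    obtain q where q: "out P [enc q, n] = Some k" "length q = the_enat (Kc P k n)"
      using Kc_program[OF assms(2)] by blast
    text \<open>The excess \<open>2 d + b\<close> makes the input \<open>0\<^sup>d 1 b q p z\<close> encode its own \<open>n\<close>, while
      \<open>d \<ge> c\<close> absorbs the optimality constant.\<close>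
    define m where "m = k - length q - length p - 3"
    define d where "d = m div 2"
    define b where "b = odd m"
    have m: "length p + length q + 2 * c + 4 \<le> k" using p(1) q(2) by linarith
    have db: "2 * d + of_bool b = m" unfolding d_def b_def by (cases "odd m") auto
    have d: "c \<le> d" using m unfolding d_def m_def by linarith
    define Z where "Z = {z :: bool list. length z = Suc n - k}"
    have "\<exists>p' y. length p' \<le> n \<and> halts U [enc p'] \<and> t < runtime U [enc p'] \<and>
        out U [enc p'] = Some (prod_encode (enc z, y))" if z: "z \<in> Z" for z
    proof -
      define w where "w = replicate d False @ True # b # q @ p @ z"
      have n: "n = length w + d + of_bool b"
        using z m k db unfolding w_def Z_def m_def by simp
      obtain y T where yT: "halts_within U [enc p] T" "out V [enc w] = Some (prod_encode (enc z, y))"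
        "prod_encode (enc z, y) \<notin> outputs_within U n T"
        using V[OF w_def n q(1) _ p(2)] z unfolding Z_def by blast
      obtain p' where p': "length p' \<le> length w + c" "out U [enc p'] = Some (prod_encode (enc z, y))"
        using optimal_program[OF c yT(2)] by blast
      have len: "length p' \<le> n" using p'(1) n d by linarith
      have "t < T" using yT(1) p(3) by (simp add: halts_within_iff_runtime)
      then show ?thesis using not_outputs_within_imp_runtime[OF p'(2) len yT(3)] p'(2) len
        by (intro exI[of _ p'] exI[of _ y]) auto
    qed
    then obtain f y where f: "\<And>z. z \<in> Z \<Longrightarrow> length (f z) \<le> n \<and> halts U [enc (f z)] \<and>
        t < runtime U [enc (f z)] \<and> out U [enc (f z)] = Some (prod_encode (enc z, y z))"
      by metis
    have "inj_on f Z"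
    proof (rule inj_onI)
      fix z z' assume "z \<in> Z" "z' \<in> Z" "f z = f z'"
      then have "prod_encode (enc z, y z) = prod_encode (enc z', y z')" using f by (metis option.inject)
      then show "z = z'" by (simp add: prod_encode_eq inj_eq[OF inj_enc])
    qed
    moreover have "f ` Z \<subseteq> {p. length p \<le> n \<and> halts U [enc p] \<and> t < runtime U [enc p]}"
      using f by auto
    ultimately have "card Z \<le> still_running U n t"
      unfolding still_running_def by (intro card_inj_on_le[of f] finite_length_le)
    moreover have "card Z = 2 * 2 ^ (n - k)"
      using k by (simp add: Z_def card_length_eq Suc_diff_le)
    moreover have "(2::nat) ^ (n - k) > 0" by simp
    ultimately show False using few by linarith
  qed
  then show ?thesis by blast
qed

lemma card_halting_within:
  "card (halting_within U n t) + still_running U n t = card {p. length p \<le> n \<and> halts U [enc p]}"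
proof -
  have "{p. length p \<le> n \<and> halts U [enc p]} = halting_within U n t \<union>
      {p. length p \<le> n \<and> halts U [enc p] \<and> t < runtime U [enc p]}"
    by (auto simp: halting_within_def halts_within_iff_runtime)
  moreover have "halting_within U n t \<inter>
      {p. length p \<le> n \<and> halts U [enc p] \<and> t < runtime U [enc p]} = {}"
    by (auto simp: halting_within_def halts_within_iff_runtime)
  ultimately show ?thesis
    unfolding still_running_def
    by (simp add: card_Un_disjoint finite_halting_within finite_length_le)
qed

lemma halting_within_mono: "s \<le> t \<Longrightarrow> halting_within U n s \<subseteq> halting_within U n t"
  by (auto simp: halting_within_def intro: halts_within_mono)

lemma all_halting_within: "\<exists>T. still_running U n T = 0"
proof -
  let ?H = "{p. length p \<le> n \<and> halts U [enc p]}"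
  have "finite ((\<lambda>p. runtime U [enc p]) ` ?H)" by (intro finite_imageI finite_length_le)
  then obtain T where T: "\<forall>x\<in>(\<lambda>p. runtime U [enc p]) ` ?H. x \<le> T"
    using finite_nat_set_iff_bounded_le by blast
  then have "length p \<le> n \<Longrightarrow> halts U [enc p] \<Longrightarrow> runtime U [enc p] \<le> T" for p by blast
  then have "{p. length p \<le> n \<and> halts U [enc p] \<and> T < runtime U [enc p]} = {}"
    using not_le by blast
  then show ?thesis unfolding still_running_def by (intro exI[of _ T]) (simp only: card.empty)
qed

text \<open>Strings of length \<open>m\<close> are those with \<open>Suc (enc r)\<close> from
  \<open>2 ^ m\<close> to \<open>2 ^ Suc m - 1\<close>. The one at offset \<open>s\<close> thus
  transmits \<open>s\<close> by its position and \<open>m\<close> by its length.\<close>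

lemma ex_length_enc:
  assumes "s < 2 ^ m"
  shows "\<exists>r. length r = m \<and> Suc (enc r) - 2 ^ length r = s"
proof -
  define r where "r = dec (2 ^ m + s - 1)"
  have "(2::nat) ^ m > 0" by simp
  then have r: "Suc (enc r) = 2 ^ m + s" by (simp add: r_def)
  have "(2::nat) ^ length r < 2 ^ Suc m"
    using enc_lower_bound[of r] assms unfolding r power_Suc by linarith
  then have "length r \<le> m" by (metis less_Suc_eq_le one_less_numeral_iff power_less_imp_less_exp semiring_norm(76))
  have "(2::nat) ^ m < 2 ^ Suc (length r)"
    using enc_upper_bound[of r] unfolding r by linarith
  then have "m \<le> length r" by (metis less_Suc_eq_le one_less_numeral_iff power_less_imp_less_exp semiring_norm(76))
  with \<open>length r \<le> m\<close> have "length r = m" by simp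
  then show ?thesis using r by (intro exI[of _ r]) simp
qed

lemma many_running_imp_le_BB:
  assumes "optimal U" "optimal_pf P"
  shows "\<exists>c. \<forall>n k t. k \<le> n \<longrightarrow> still_running U n t > 2 ^ (n - k) \<longrightarrow>
    t \<le> BB U (int k + int (the_enat (Kc P n 0)) + int c)"
proof -
  have "prefix_free_cond P" using assms(2) by (simp add: optimal_pf_def)
  from counting_machine[OF this, of U] obtain V where V: "\<And>d q r n w s T.
    w = replicate d False @ True # q @ r \<Longrightarrow>
    out P [enc q, 0] = Some n \<Longrightarrow> s = Suc (enc r) - 2 ^ length r \<Longrightarrow>
    s * 2 ^ (n - (length r - 1)) \<le> card (halting_within U n T) \<Longrightarrow>
    \<exists>x T. out V [enc w] = Some x \<and> s * 2 ^ (n - (length r - 1)) \<le> card (halting_within U n T) \<and>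
      x \<notin> outputs_within U (length w + d) T"
    by metis
  obtain c where c: "\<forall>x. C U x \<le> C V x + enat c" using assms(1) unfolding optimal_def by blast
  \<comment> \<open>The unary prefix of \<open>w\<close> takes \<open>c + 1\<close> bits,
    \<open>r\<close> takes \<open>k + 1\<close>, and optimality adds \<open>c\<close>.\<close>
  have "t \<le> BB U (int k + int (the_enat (Kc P n 0)) + int (2 * c + 2))"
    if k: "k \<le> n" and many: "still_running U n t > 2 ^ (n - k)" for n k t
  proof -
    obtain q where q: "out P [enc q, 0] = Some n" "length q = the_enat (Kc P n 0)"
      using Kc_program[OF assms(2)] by blast
    define N where "N = card {p. length p \<le> n \<and> halts U [enc p]}"
    define s where "s = N div 2 ^ (n - k)"
    have "N \<le> card {p :: bool list. length p \<le> n}"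
      unfolding N_def using finite_length_le[of n "\<lambda>_. True"] by (intro card_mono) auto
    then have "N < 2 ^ Suc n" using card_length_le[of n] by linarith
    also have "(2::nat) ^ Suc n = 2 ^ Suc k * 2 ^ (n - k)"
      using k by (simp flip: power_add)
    finally have "s < 2 ^ Suc k" unfolding s_def by (simp add: less_mult_imp_div_less)
    then obtain r where r: "length r = Suc k" "Suc (enc r) - 2 ^ length r = s"
      using ex_length_enc by blast
    have sN: "s * 2 ^ (n - k) \<le> N" "N < s * 2 ^ (n - k) + 2 ^ (n - k)"
    proof -
      have "N mod 2 ^ (n - k) < 2 ^ (n - k)" by simp
      then show "s * 2 ^ (n - k) \<le> N" "N < s * 2 ^ (n - k) + 2 ^ (n - k)"
        unfolding s_def using div_mult_mod_eq[of N "2 ^ (n - k)"] by linarith+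
    qed
    \<comment> \<open>At \<open>T0\<close> all terminating inputs have halted, so the search for a
      time with \<open>s * 2 ^ (n - k)\<close> halted inputs succeeds.\<close>
    obtain T0 where "still_running U n T0 = 0" using all_halting_within by blast
    then have "s * 2 ^ (n - k) \<le> card (halting_within U n T0)"
      using card_halting_within[of U n T0] sN(1) by (simp add: N_def)
    \<comment> \<open>With \<open>d = c\<close>, the output is fresh for all inputs up to length
      \<open>length w + c\<close>, the bound that optimality gives for a program of
      \<open>U\<close>.\<close>
    moreover define w where "w = replicate c False @ True # q @ r"
    ultimately obtain x T where T: "out V [enc w] = Some x"
      "s * 2 ^ (n - k) \<le> card (halting_within U n T)" "x \<notin> outputs_within U (length w + c) T"
      using V[OF w_def q(1) r(2)[symmetric], of T0] r(1) by auto
    \<comment> \<open>Otherwise \<open>s * 2 ^ (n - k)\<close> inputs have halted by time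
      \<open>t\<close>, which leaves fewer than \<open>2 ^ (n - k)\<close> of the \<open>N\<close>
      running.\<close>
    have "t < T"
    proof (rule ccontr)
      assume "\<not> t < T"
      then have "card (halting_within U n T) \<le> card (halting_within U n t)"
        by (intro card_mono finite_halting_within halting_within_mono) simp
      then show False using T(2) sN(2) many card_halting_within[of U n t] by (simp add: N_def)
    qed
    obtain p where p: "length p \<le> length w + c" "out U [enc p] = Some x"
      using optimal_program[OF c T(1)] by blast
    have run: "halts U [enc p]" "T < runtime U [enc p]"
      using not_outputs_within_imp_runtime[OF p(2,1) T(3)] by auto
    have "int (length p) \<le> int k + int (the_enat (Kc P n 0)) + int (2 * c + 2)"
      using p(1) q(2) r(1) by (simp add: w_def)
    from runtime_le_BB[OF this run(1)] show ?thesis using run(2) \<open>t < T\<close> by linarith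
  qed
  then show ?thesis by blast
qed

text \<open>Lets the constants of the two bounds be replaced by their maximum.\<close>

lemma BB_mono: "m \<le> m' \<Longrightarrow> BB U m \<le> BB U m'"
  unfolding BB_def using finite_BB_set by (intro Max_mono) fastforce+

theorem theorem6p2:
  assumes "optimal U" and "optimal_pf P"
  shows "\<exists>c::nat. \<forall>n k t. k \<le> n \<longrightarrow>
    (still_running U n t \<le> 2 ^ (n - k) \<longrightarrow>
       BB U (int k - int (the_enat (Kc P k n)) - int c) \<le> t) \<and>
    (still_running U n t > 2 ^ (n - k) \<longrightarrow>
       t \<le> BB U (int k + int (the_enat (Kc P n 0)) + int c))"
proof -
  obtain c1 where c1: "\<And>n k t. k \<le> n \<Longrightarrow> still_running U n t \<le> 2 ^ (n - k) \<Longrightarrow>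
      BB U (int k - int (the_enat (Kc P k n)) - int c1) \<le> t"
    using few_running_imp_ge_BB[OF assms] by blast
  obtain c2 where c2: "\<And>n k t. k \<le> n \<Longrightarrow> still_running U n t > 2 ^ (n - k) \<Longrightarrow>
      t \<le> BB U (int k + int (the_enat (Kc P n 0)) + int c2)"
    using many_running_imp_le_BB[OF assms] by blast
  show ?thesis
  proof (intro exI[of _ "max c1 c2"] allI impI conjI)
    fix n k t assume "k \<le> n" "still_running U n t \<le> 2 ^ (n - k)"
    from c1[OF this] show "BB U (int k - int (the_enat (Kc P k n)) - int (max c1 c2)) \<le> t"
      by (rule order_trans[rotated]) (rule BB_mono, simp)
  next
    fix n k t assume "k \<le> n" "still_running U n t > 2 ^ (n - k)"
    from c2[OF this] show "t \<le> BB U (int k + int (the_enat (Kc P n 0)) + int (max c1 c2))"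
      by (rule order_trans) (rule BB_mono, simp)
  qed
qed

end
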